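(* Let $a_1,\ldots,a_n,b_1,\ldots,b_n$ be positive integers and let $M$ be the nested matroid $$U_{a_1,a_1+b_1}\mathbin{\Box} U_{a_2,a_2+b_2}\mathbin{\Box}\cdots\mathbin{\Box} U_{a_n,a_n+b_n}.$$ The matroid $M$ is extremal if any of the following conditions holds: (i) $a_i<a_{i+1}$ for each $i\in[n-1]$; (i$'$) $b_{i+1}<b_i$ for each $i\in[n-1]$; (i$''$) $n\ge 3$ and there is some $k\in[n-2]$ such that $a_i<a_{i+1}$ for each $i\in[k]$ and $b_{i+1}<b_i$ for each $i\in[n-1]-[k]$.
   Context: $[n]=\{1,\ldots,n\}$. $U_{r,n}$ is the uniform matroid of rank $r$ on $n$ elements (the factors are taken on pairwise disjoint ground sets). For matroids $M,N$ on disjoint ground sets, the free product $M\mathbin{\Box}N$ is the matroid on $E(M)\cup E(N)$ whose independent sets are the sets $I\cup J$ where $I$ is independent in $M$, $J\subseteq E(N)$, and $|I\cup J|\le r(M)+r_N(J)$. This operation is associative. For a matroid $M$ on $[n]$, $\mathcal{P}(M)\subset\mathbb{R}^n$ is the convex hull of the characteristic vectors of the bases of $M$. For $X\subseteq\mathbb{R}^n$ with indicator function $\bar{\mathbb{I}}(X)$, the symmetrized indicator function is $\mathbb{I}(X)(x_1,\ldots,x_n)=\frac{1}{n!}\sum_{\sigma\in S_n}\bar{\mathbb{I}}(X)(x_{\sigma(1)},\ldots,x_{\sigma(n)})$. $\mathbb{I}(\mathcal{P}(M))$ depends only on the isomorphism class of $M$, so it is defined for matroids on any $n$-element ground set and for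 unlabeled matroids (isomorphism classes). A cyclic flat of $M$ is a flat that is a (possibly empty) union of circuits; $M$ is nested if its cyclic flats form a chain under inclusion. Fix a linear order $N_1,\ldots,N_{\binom nr}$ of the unlabeled rank-$r$ nested matroids on $n$ elements. By a theorem of Derksen and Fink, for each rank-$r$ matroid $M$ on $n$ elements there is a unique integer vector $\boldsymbol{v}_M=(v_1,\ldots,v_{\binom nr})$ with $\mathbb{I}(\mathcal{P}(M))=\sum_i v_i\,\mathbb{I}(\mathcal{P}(N_i))$. The polytope $\Omega_{r,n}$ is the convex hull of all vectors $\boldsymbol{v}_M$, $M$ ranging over rank-$r$ matroids on $n$ elements. $M$ is extremal if $\boldsymbol{v}_M$ is a vertex of $\Omega_{r,n}$. *)

theory Defs
  imports "HOL-Analysis.Analysis"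
begin

section \<open>Matroids\<close>

datatype 'a set_system = Set_System (ground: "'a set") (indep: "'a set set")

definition matroid :: "'a set_system \<Rightarrow> bool" where
  "matroid M \<longleftrightarrow>
     finite (ground M) \<and> indep M \<subseteq> Pow (ground M) \<and> {} \<in> indep M \<and>
     (\<forall>I\<in>indep M. \<forall>J\<subseteq>I. J \<in> indep M) \<and>
     (\<forall>I\<in>indep M. \<forall>J\<in>indep M. card I < card J \<longrightarrow> (\<exists>e\<in>J - I. insert e I \<in> indep M))"

definition rk :: "'a set_system \<Rightarrow> 'a set \<Rightarrow> nat" where
  "rk M X = Max (card ` {I \<in> indep M. I \<subseteq> X})"

definition bases :: "'a set_system \<Rightarrow> 'a set set" where
  "bases M = {B \<in> indep M. \<forall>I\<in>indep M. B \<subseteq> I \<longrightarrow> I = B}"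

definition circuits :: "'a set_system \<Rightarrow> 'a set set" where
  "circuits M = {C. C \<subseteq> ground M \<and> C \<notin> indep M \<and> (\<forall>D. D \<subset> C \<longrightarrow> D \<in> indep M)}"

definition flats :: "'a set_system \<Rightarrow> 'a set set" where
  "flats M = {F. F \<subseteq> ground M \<and> (\<forall>e\<in>ground M - F. rk M F < rk M (insert e F))}"

definition cyclic_flats :: "'a set_system \<Rightarrow> 'a set set" where
  "cyclic_flats M = {F \<in> flats M. \<exists>\<C>\<subseteq>circuits M. F = \<Union>\<C>}"

definition nested :: "'a set_system \<Rightarrow> bool" where
  "nested M \<longleftrightarrow> matroid M \<and> (\<forall>F\<in>cyclic_flats M. \<forall>G\<in>cyclic_flats M. F \<subseteq> G \<or> G \<subseteq> F)"

definition matroid_iso :: "'a set_system \<Rightarrow> 'b set_system \<Rightarrow> bool" where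
  "matroid_iso M N \<longleftrightarrow>
     (\<exists>f. bij_betw f (ground M) (ground N) \<and>
          (\<forall>X\<subseteq>ground M. X \<in> indep M \<longleftrightarrow> f ` X \<in> indep N))"

definition uniform_matroid :: "nat \<Rightarrow> 'a set \<Rightarrow> 'a set_system" where
  "uniform_matroid r S = Set_System S {X. X \<subseteq> S \<and> finite X \<and> card X \<le> r}"

definition free_product :: "'a set_system \<Rightarrow> 'a set_system \<Rightarrow> 'a set_system" where
  "free_product M N = Set_System (ground M \<union> ground N)
     {I \<union> J | I J. I \<in> indep M \<and> J \<subseteq> ground N \<and> card (I \<union> J) \<le> rk M (ground M) + rk N J}"

text \<open>The free product is associative, so bracketing to the right is no restriction.
  The value on the empty list is irrelevant.\<close>

fun free_products :: "'a set_system list \<Rightarrow> 'a set_system" where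
  "free_products [] = uniform_matroid 0 {}"
| "free_products [M] = M"
| "free_products (M # N # Ms) = free_product M (free_products (N # Ms))"

section \<open>Symmetrized indicator functions of matroid polytopes\<close>

text \<open>From here on matroids have the whole finite type \<^typ>\<open>'e\<close> as ground set; \<^typ>\<open>'e\<close> plays
  the role of the label set \<open>[n]\<close>, so \<open>n\<close> is \<open>CARD('e)\<close>.\<close>

definition matroids_of_rank :: "nat \<Rightarrow> 'e::finite set_system set" where
  "matroids_of_rank r = {M. matroid M \<and> ground M = UNIV \<and> rk M UNIV = r}"

definition char_vec :: "'e::finite set \<Rightarrow> real ^ 'e" where
  "char_vec B = (\<chi> i. indicator B i)"

definition matroid_polytope :: "'e::finite set_system \<Rightarrow> (real ^ 'e) set" where
  "matroid_polytope M = convex hull (char_vec ` bases M)"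

definition sym_indicator :: "(real ^ 'e::finite) set \<Rightarrow> real ^ 'e \<Rightarrow> real" where
  "sym_indicator X x =
     (1 / fact CARD('e)) * (\<Sum>\<sigma> | \<sigma> permutes (UNIV :: 'e set). indicator X (\<chi> i. x $ \<sigma> i))"

text \<open>\<open>N\<close> lists exactly one representative of each isomorphism class of rank-\<open>r\<close> nested matroids
  on \<^typ>\<open>'e\<close>. There are \<open>n choose r\<close> such classes, so this determines the size of the index
  type \<^typ>\<open>'k\<close>.\<close>

definition enumerates_nested :: "nat \<Rightarrow> ('k::finite \<Rightarrow> 'e::finite set_system) \<Rightarrow> bool" where
  "enumerates_nested r N \<longleftrightarrow>
     (\<forall>i. N i \<in> matroids_of_rank r \<and> nested (N i)) \<and>
     (\<forall>M\<in>(matroids_of_rank r :: 'e set_system set). nested M \<longrightarrow> (\<exists>!i. matroid_iso M (N i)))"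

text \<open>\<open>is_coord_vec N M v\<close> says that \<open>v\<close> is the vector $v_M$ with respect to the enumeration \<open>N\<close>.
  By Derksen and Fink there is exactly one such \<open>v\<close> for each \<open>M\<close>; stating the defining
  property as a relation keeps the definitions meaningful without having that theorem at hand.\<close>

definition is_coord_vec ::
  "('k::finite \<Rightarrow> 'e::finite set_system) \<Rightarrow> 'e set_system \<Rightarrow> real ^ 'k \<Rightarrow> bool" where
  "is_coord_vec N M v \<longleftrightarrow> (\<forall>i. v $ i \<in> \<int>) \<and>
     (\<forall>x. sym_indicator (matroid_polytope M) x =
          (\<Sum>i\<in>UNIV. v $ i * sym_indicator (matroid_polytope (N i)) x))"

definition Omega :: "nat \<Rightarrow> ('k::finite \<Rightarrow> 'e::finite set_system) \<Rightarrow> (real ^ 'k) set" where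
  "Omega r N = convex hull {v. \<exists>M\<in>matroids_of_rank r. is_coord_vec N M v}"

definition extremal :: "('k::finite \<Rightarrow> 'e::finite set_system) \<Rightarrow> 'e set_system \<Rightarrow> bool" where
  "extremal N M \<longleftrightarrow> (\<exists>v. is_coord_vec N M v \<and> v extreme_point_of (Omega (rk M UNIV) N))"

text \<open>The existential quantifier in \<^const>\<open>extremal\<close> cannot pick one of several vectors: two
  different vectors for \<open>M\<close> could be reflected in each other, and neither would be extreme.\<close>

lemma extremal_imp_unique_coord_vec:
  assumes "extremal N M" "matroid M" "ground M = UNIV"
  shows "\<exists>!v. is_coord_vec N M v"
proof -
  obtain v where v: "is_coord_vec N M v" "v extreme_point_of (Omega (rk M UNIV) N)"
    using assms(1) by (auto simp: extremal_def)
  have "w = v" if w: "is_coord_vec N M w" for w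
  proof (rule ccontr)
    assume neq: "w \<noteq> v"
    define u where "u = 2 *\<^sub>R v - w"
    have u: "is_coord_vec N M u"
      unfolding is_coord_vec_def
    proof (intro conjI allI)
      show "u $ i \<in> \<int>" for i
        using v(1) w by (simp add: u_def is_coord_vec_def)
      show "sym_indicator (matroid_polytope M) x =
            (\<Sum>i\<in>UNIV. u $ i * sym_indicator (matroid_polytope (N i)) x)" for x
      proof -
        have "(\<Sum>i\<in>UNIV. u $ i * sym_indicator (matroid_polytope (N i)) x) =
          2 * (\<Sum>i\<in>UNIV. v $ i * sym_indicator (matroid_polytope (N i)) x) -
          (\<Sum>i\<in>UNIV. w $ i * sym_indicator (matroid_polytope (N i)) x)"
          by (simp add: u_def sum_distrib_left sum_subtractf algebra_simps)
        then show ?thesis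
          using v(1) w by (simp add: is_coord_vec_def)
      qed
    qed
    have "M \<in> matroids_of_rank (rk M UNIV)"
      using assms by (simp add: matroids_of_rank_def)
    then have "u \<in> Omega (rk M UNIV) N" "w \<in> Omega (rk M UNIV) N"
      unfolding Omega_def using u w by (auto intro!: hull_inc)
    moreover have "v = midpoint w u"
      by (simp add: midpoint_def u_def)
    moreover have "w \<noteq> u"
      using neq \<open>v = midpoint w u\<close> by (auto simp: midpoint_eq_endpoint)
    ultimately show False
      using v(2) by (metis extreme_point_of_def midpoint_in_open_segment)
  qed
  then show ?thesis using v(1) by blast
qed

end

theory Submission
  imports Defs
begin

text \<open>
Extremality of \<open>M\<close> is shown by a linear functional that attains its maximum over all coordinate
vectors only at the coordinate vector of \<open>M\<close>. Such functionals come from counting complete flags of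
subsets by their ranks.

For a flag and a bound on the rank of each of its members, the bounds hold if and only if the
polytope of the matroid meets an intersection of halfspaces. Sending a compact convex set to \<open>1\<close> if
it is nonempty and to \<open>0\<close> otherwise respects linear relations between indicator functions
(\<open>sum_compact_convex_nonempty_eq_0\<close>). Therefore the sum of any function of the rank sequence over all
complete flags is a linear functional of the symmetrized indicator function (\<open>flag_sum_linear\<close>), and
its value at a matroid is computed from any coordinate vector of that matroid.

Coordinate vectors are unique because the symmetrized indicator functions of the nested matroids are
linearly independent (\<open>nested_sym_indicators_independent\<close>): a nested matroid is the freest matroid
with the given ranks along a flag through its cyclic flats, so suitable flag counts form a triangular
matrix.

The free product of the \<open>U\<^bsub>a i,a i + b i\<^esub>\<close> is the matroid whose independent sets meet
\<open>F i = S 1 \<union> \<dots> \<union> S i\<close> in at most \<open>a 1 + \<dots> + a i\<close> elements (\<open>free_products_uniform_eq_capped\<close>). In it,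
all sets of size \<open>size_upto (i - 1) + a i\<close> have rank at least \<open>a 1 + \<dots> + a i\<close>, where \<open>size_upto i\<close> is the
size of \<open>F i\<close>. Call a matroid of the same rank spread if it has this property, and call a flag tight
if its member of size \<open>size_upto i\<close> has rank at most \<open>a 1 + \<dots> + a i\<close>, for all \<open>i\<close>. The functional
penalizes matroids that are not spread, then rewards tight flags, then rewards bases. The hypotheses
on \<open>a\<close> and \<open>b\<close> enter through submodularity: in a spread matroid the members of a tight flag of the
sizes \<open>size_upto i\<close> are unique (\<open>tight_flags_unique\<close>). So a spread matroid with a tight flag has as many
tight flags as \<open>M\<close>, and after relabelling that flag to the sets \<open>F i\<close> it satisfies the capacities of
\<open>M\<close>. Its bases are then bases of \<open>M\<close>, and it has equally many only if it is \<open>M\<close> itself.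
\<close>

section \<open>Rank and closure in matroids\<close>

lemma matroid_indep_subset_ground: "matroid M \<Longrightarrow> I \<in> indep M \<Longrightarrow> I \<subseteq> ground M"
  by (auto simp: matroid_def)

lemma matroid_indep_finite: "matroid M \<Longrightarrow> I \<in> indep M \<Longrightarrow> finite I"
  by (meson finite_subset matroid_def matroid_indep_subset_ground)

lemma matroid_indep_subset: "matroid M \<Longrightarrow> I \<in> indep M \<Longrightarrow> J \<subseteq> I \<Longrightarrow> J \<in> indep M"
  by (auto simp: matroid_def)

lemma matroid_empty_indep: "matroid M \<Longrightarrow> {} \<in> indep M"
  by (auto simp: matroid_def)

lemma matroid_augment:
  "matroid M \<Longrightarrow> I \<in> indep M \<Longrightarrow> J \<in> indep M \<Longrightarrow> card I < card J \<Longrightarrow>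
    \<exists>e\<in>J - I. insert e I \<in> indep M"
  by (auto simp: matroid_def)

lemma matroid_finite_indep: "matroid M \<Longrightarrow> finite (indep M)"
  by (auto simp: matroid_def intro: finite_subset)

lemma card_le_rk: "matroid M \<Longrightarrow> I \<in> indep M \<Longrightarrow> I \<subseteq> X \<Longrightarrow> card I \<le> rk M X"
  unfolding rk_def using matroid_finite_indep[of M] by (intro Max_ge) auto

lemma rk_attained:
  assumes "matroid M"
  obtains I where "I \<in> indep M" "I \<subseteq> X" "card I = rk M X"
proof -
  have "rk M X \<in> card ` {I \<in> indep M. I \<subseteq> X}"
    unfolding rk_def using matroid_finite_indep[OF assms] matroid_empty_indep[OF assms]
    by (intro Max_in) auto
  then show thesis using that by auto
qed

lemma rk_mono: "matroid M \<Longrightarrow> X \<subseteq> Y \<Longrightarrow> rk M X \<le> rk M Y"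
  by (metis card_le_rk order_trans rk_attained)

lemma rk_le_card: "matroid M \<Longrightarrow> finite X \<Longrightarrow> rk M X \<le> card X"
  by (metis card_mono rk_attained)

lemma rk_eq_card_iff_indep:
  assumes "matroid M" "finite X"
  shows "rk M X = card X \<longleftrightarrow> X \<in> indep M"
  by (metis assms card_le_rk card_subset_eq le_antisym order_refl rk_attained rk_le_card)

lemma indep_extends_to_rk:
  assumes M: "matroid M" and I: "I \<in> indep M" "I \<subseteq> X"
  obtains B where "B \<in> indep M" "I \<subseteq> B" "B \<subseteq> X" "card B = rk M X"
proof -
  have "\<exists>B. B \<in> indep M \<and> I \<subseteq> B \<and> B \<subseteq> X \<and> card B = rk M X"
    using I
  proof (induction "rk M X - card I" arbitrary: I rule: less_induct)
    case less
    show ?case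
    proof (cases "card I = rk M X")
      case False
      obtain J where J: "J \<in> indep M" "J \<subseteq> X" "card J = rk M X"
        using rk_attained[OF M] .
      have lt: "card I < rk M X"
        using False card_le_rk[OF M less.prems] by simp
      then obtain e where e: "e \<in> J - I" "insert e I \<in> indep M"
        using matroid_augment[OF M less.prems(1) J(1)] J(3) by auto
      have "card (insert e I) = Suc (card I)"
        using e matroid_indep_finite[OF M less.prems(1)] by auto
      then have "\<exists>B. B \<in> indep M \<and> insert e I \<subseteq> B \<and> B \<subseteq> X \<and> card B = rk M X"
        using e J(2) less.prems lt by (intro less.hyps) auto
      then show ?thesis by blast
    qed (use less.prems in blast)
  qed
  then show thesis using that by blast
qed

lemma rk_le_rk_plus_card_diff:
  assumes M: "matroid M" and "X \<subseteq> Y" "finite Y"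
  shows "rk M Y \<le> rk M X + card (Y - X)"
proof -
  obtain I where I: "I \<in> indep M" "I \<subseteq> Y" "card I = rk M Y"
    using rk_attained[OF M] .
  have "card (I \<inter> X) \<le> rk M X"
    by (intro card_le_rk[OF M] matroid_indep_subset[OF M I(1)]) auto
  moreover have "card (I - X) \<le> card (Y - X)"
    using I assms by (intro card_mono) auto
  moreover have "card I = card (I \<inter> X) + card (I - X)"
    using matroid_indep_finite[OF M I(1)] by (metis card_Int_Diff)
  ultimately show ?thesis using I(3) by simp
qed

lemma rk_submodular:
  assumes M: "matroid M"
  shows "rk M (X \<union> Y) + rk M (X \<inter> Y) \<le> rk M X + rk M Y"
proof -
  obtain I where I: "I \<in> indep M" "I \<subseteq> X \<inter> Y" "card I = rk M (X \<inter> Y)"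
    using rk_attained[OF M] .
  have "I \<subseteq> X \<union> Y" using I(2) by blast
  then obtain B where B: "B \<in> indep M" "I \<subseteq> B" "B \<subseteq> X \<union> Y" "card B = rk M (X \<union> Y)"
    using indep_extends_to_rk[OF M I(1)] by metis
  have fin: "finite B" using matroid_indep_finite[OF M B(1)] .
  have "card (B \<inter> X) + card (B \<inter> Y) = card B + card (B \<inter> X \<inter> Y)"
    using card_Un_Int[of "B \<inter> X" "B \<inter> Y"] fin B(3)
    by (simp add: Int_Un_distrib[symmetric] Int_absorb2 Int_assoc Int_left_commute)
  moreover have "card I \<le> card (B \<inter> X \<inter> Y)"
    using fin B I by (intro card_mono) auto
  moreover have "card (B \<inter> X) \<le> rk M X" "card (B \<inter> Y) \<le> rk M Y"
    by (auto intro!: card_le_rk[OF M] matroid_indep_subset[OF M B(1)])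
  ultimately show ?thesis using B I by linarith
qed

lemma rk_Un_eq_if_rk_insert_eq:
  assumes M: "matroid M" and eq: "\<And>e. e \<in> Y \<Longrightarrow> rk M (insert e X) = rk M X"
  shows "rk M (X \<union> Y) = rk M X"
proof (rule ccontr)
  assume "rk M (X \<union> Y) \<noteq> rk M X"
  then have lt: "rk M X < rk M (X \<union> Y)"
    using rk_mono[OF M, of X "X \<union> Y"] by auto
  obtain I where I: "I \<in> indep M" "I \<subseteq> X" "card I = rk M X"
    using rk_attained[OF M] .
  obtain J where J: "J \<in> indep M" "J \<subseteq> X \<union> Y" "card J = rk M (X \<union> Y)"
    using rk_attained[OF M] .
  obtain e where e: "e \<in> J - I" "insert e I \<in> indep M"
    using matroid_augment[OF M I(1) J(1)] lt I J by auto
  have "card (insert e I) = Suc (card I)"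
    using e matroid_indep_finite[OF M I(1)] by auto
  moreover have "card (insert e I) \<le> rk M (insert e X)"
    using I by (intro card_le_rk[OF M e(2)]) auto
  moreover have "rk M (insert e X) = rk M X"
    using e J eq[of e] by (cases "e \<in> X") (auto simp: insert_absorb)
  ultimately show False using I by simp
qed

lemma base_if_card_eq_rk:
  assumes M: "matroid M" and B: "B \<in> indep M" "card B = rk M (ground M)"
  shows "B \<in> bases M"
proof -
  have "I = B" if "I \<in> indep M" "B \<subseteq> I" for I
  proof -
    have "card I \<le> card B"
      using card_le_rk[OF M that(1) matroid_indep_subset_ground[OF M that(1)]] B by simp
    then show ?thesis
      using that matroid_indep_finite[OF M that(1)] by (metis card_seteq)
  qed
  then show ?thesis using B unfolding bases_def by auto
qed

lemma ex_circuit_subset: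
  assumes M: "matroid M" and X: "X \<subseteq> ground M" "X \<notin> indep M"
  obtains C where "C \<in> circuits M" "C \<subseteq> X"
proof -
  have "finite X" using X M by (auto simp: matroid_def intro: finite_subset)
  then have "\<exists>C\<in>circuits M. C \<subseteq> X"
    using X
  proof (induction X rule: finite_psubset_induct)
    case (psubset X)
    show ?case
    proof (cases "X \<in> circuits M")
      case False
      then obtain D where "D \<subset> X" "D \<notin> indep M"
        using psubset.prems by (auto simp: circuits_def)
      then show ?thesis using psubset.IH[of D] psubset.prems by blast
    qed auto
  qed
  then show thesis using that by blast
qed

text \<open>The closure of a circuit is a cyclic flat, and it has the rank of the circuit, which is one less
than its size. So a dependent set already violates the bound on the closure of any circuit that
it contains. In particular a matroid is the freest one with the given ranks on its cyclic flats.\<close>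

lemma indep_iff_cyclic_flats:
  assumes M: "matroid M" and X: "X \<subseteq> ground M"
  shows "X \<in> indep M \<longleftrightarrow> (\<forall>Z\<in>cyclic_flats M. card (X \<inter> Z) \<le> rk M Z)"
proof
  assume "X \<in> indep M"
  then show "\<forall>Z\<in>cyclic_flats M. card (X \<inter> Z) \<le> rk M Z"
    using card_le_rk[OF M matroid_indep_subset[OF M]] by (meson Int_lower1 Int_lower2)
next
  assume cap: "\<forall>Z\<in>cyclic_flats M. card (X \<inter> Z) \<le> rk M Z"
  show "X \<in> indep M"
  proof (rule ccontr)
    assume "X \<notin> indep M"
    then obtain C where C: "C \<in> circuits M" "C \<subseteq> X"
      using ex_circuit_subset[OF M X] by blast
    have finC: "finite C"
      using C M by (auto simp: matroid_def circuits_def intro: finite_subset)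
    have Cg: "C \<subseteq> ground M" and Cd: "C \<notin> indep M" and Cm: "\<And>D. D \<subset> C \<Longrightarrow> D \<in> indep M"
      using C by (auto simp: circuits_def)
    have "C \<noteq> {}" using Cd matroid_empty_indep[OF M] by auto
    then obtain c where c: "c \<in> C" by auto
    then have I: "C - {c} \<in> indep M" by (intro Cm) auto
    have rkC: "Suc (rk M C) = card C"
    proof -
      have "card (C - {c}) \<le> rk M C" using I by (intro card_le_rk[OF M]) auto
      moreover have "rk M C < card C"
        using rk_le_card[OF M finC] rk_eq_card_iff_indep[OF M finC] Cd by linarith
      moreover have "Suc (card (C - {c})) = card C" using finC c by (rule card_Suc_Diff1)
      ultimately show ?thesis by simp
    qed
    define Z where "Z = {e \<in> ground M. rk M (insert e C) = rk M C}"
    have CZ: "C \<subseteq> Z" using Cg by (auto simp: Z_def insert_absorb)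
    have rkZ: "rk M Z = rk M C"
      using rk_Un_eq_if_rk_insert_eq[OF M, of Z C] CZ by (simp add: Z_def Un_absorb1)
    have "Z \<in> flats M"
    proof -
      have "rk M Z < rk M (insert e Z)" if "e \<in> ground M - Z" for e
      proof -
        have "rk M (insert e C) \<noteq> rk M C" using that by (auto simp: Z_def)
        then have "rk M C < rk M (insert e C)"
          using rk_mono[OF M subset_insertI, of C e] by simp
        also have "\<dots> \<le> rk M (insert e Z)" using CZ by (intro rk_mono[OF M]) auto
        finally show ?thesis using rkZ by simp
      qed
      then show ?thesis by (auto simp: flats_def Z_def)
    qed
    moreover have "Z = \<Union>{D \<in> circuits M. D \<subseteq> Z}"
    proof
      show "Z \<subseteq> \<Union>{D \<in> circuits M. D \<subseteq> Z}"
      proof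
        fix e assume e: "e \<in> Z"
        show "e \<in> \<Union>{D \<in> circuits M. D \<subseteq> Z}"
        proof (cases "e \<in> C")
          case True
          then show ?thesis using C CZ by auto
        next
          case False
          have "insert e (C - {c}) \<notin> indep M"
          proof
            assume "insert e (C - {c}) \<in> indep M"
            then have "card (insert e (C - {c})) \<le> rk M (insert e C)"
              by (intro card_le_rk[OF M]) auto
            moreover have "card (insert e (C - {c})) = card C"
              using False finC card_Suc_Diff1[OF finC c] by simp
            ultimately show False using e rkC by (simp add: Z_def)
          qed
          then obtain D where D: "D \<in> circuits M" "D \<subseteq> insert e (C - {c})"
            using ex_circuit_subset[OF M, of "insert e (C - {c})"] e Cg by (auto simp: Z_def)
          have "e \<in> D"
          proof (rule ccontr)
            assume "e \<notin> D"
            then have "D \<in> indep M"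
              using D(2) by (intro matroid_indep_subset[OF M I]) auto
            then show False using D(1) by (auto simp: circuits_def)
          qed
          then show ?thesis using D e CZ by blast
        qed
      qed
    qed auto
    moreover have "{D \<in> circuits M. D \<subseteq> Z} \<subseteq> circuits M" by blast
    ultimately have "Z \<in> cyclic_flats M"
      unfolding cyclic_flats_def mem_Collect_eq by (intro conjI exI[of _ "{D \<in> circuits M. D \<subseteq> Z}"])
    then have "card (X \<inter> Z) \<le> rk M Z" using cap by blast
    moreover have "finite X" using X M unfolding matroid_def by (metis finite_subset)
    then have "card C \<le> card (X \<inter> Z)" using C CZ by (intro card_mono) auto
    ultimately show False using rkZ rkC by simp
  qed
qed

section \<open>Matroids cut out by capacities on a chain of sets\<close>

text \<open>For a chain of sets \<open>F\<close> this is the general form of a nested matroid: \<open>nested_capped\<close> shows that all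
of these are nested, and \<open>indep_iff_cyclic_flats\<close> presents a nested matroid in this form, with its
cyclic flats as the chain and their ranks as the capacities.\<close>

definition capped :: "'a set \<Rightarrow> 'i set \<Rightarrow> ('i \<Rightarrow> 'a set) \<Rightarrow> ('i \<Rightarrow> nat) \<Rightarrow> 'a set_system" where
  "capped E I F h = Set_System E {X. X \<subseteq> E \<and> (\<forall>i\<in>I. card (X \<inter> F i) \<le> h i)}"

lemma ground_capped [simp]: "ground (capped E I F h) = E"
  by (simp add: capped_def)

lemma indep_capped: "X \<in> indep (capped E I F h) \<longleftrightarrow> X \<subseteq> E \<and> (\<forall>i\<in>I. card (X \<inter> F i) \<le> h i)"
  by (simp add: capped_def)

context
  fixes E :: "'a set" and I :: "'i set" and F :: "'i \<Rightarrow> 'a set" and h :: "'i \<Rightarrow> nat"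
  assumes finE: "finite E" and finI: "finite I"
    and chain: "\<And>i j. i \<in> I \<Longrightarrow> j \<in> I \<Longrightarrow> F i \<subseteq> F j \<or> F j \<subseteq> F i"
begin

lemma capped_indep_card_le:
  assumes "Y \<in> indep (capped E I F h)" "Y \<subseteq> J" "J \<subseteq> E" "i \<in> I"
  shows "card Y \<le> h i + card (J - F i)"
proof -
  have fin: "finite J" "finite Y" using assms finE by (auto intro: finite_subset)
  have "card Y = card (Y \<inter> F i) + card (Y - F i)" using fin by (metis card_Int_Diff)
  moreover have "card (Y - F i) \<le> card (J - F i)" using assms fin by (intro card_mono) auto
  ultimately show ?thesis using assms by (force simp: indep_capped)
qed

text \<open>A maximal independent subset \<open>Y\<close> of \<open>J\<close> that misses part of \<open>J\<close> is blocked by saturated members of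
the chain; the largest of these contains all of \<open>J - Y\<close>, which determines the size of \<open>Y\<close>. That
size is also an upper bound for every independent subset of \<open>J\<close>, by \<open>capped_indep_card_le\<close>, which
yields both the augmentation property and a formula for the rank.\<close>

lemma capped_maximal_card:
  assumes Y: "Y \<in> indep (capped E I F h)" "Y \<subseteq> J" "J \<subseteq> E"
    and max: "\<And>e. e \<in> J - Y \<Longrightarrow> insert e Y \<notin> indep (capped E I F h)"
    and ne: "Y \<noteq> J"
  obtains i where "i \<in> I" "card Y = h i + card (J - F i)"
proof -
  have fin: "finite Y" "finite J" using Y finE by (auto intro: finite_subset)
  define T where "T = {i \<in> I. card (Y \<inter> F i) = h i}"
  have blocked: "\<exists>i\<in>T. e \<in> F i" if e: "e \<in> J - Y" for e
  proof -
    obtain i where i: "i \<in> I" "h i < card (insert e Y \<inter> F i)"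
      using max[OF e] e Y by (auto simp: indep_capped not_le)
    have le: "card (Y \<inter> F i) \<le> h i" using Y i by (auto simp: indep_capped)
    have "e \<in> F i"
    proof (rule ccontr)
      assume "e \<notin> F i"
      then have "insert e Y \<inter> F i = Y \<inter> F i" by auto
      then show False using i le by simp
    qed
    moreover have "card (insert e Y \<inter> F i) \<le> Suc (card (Y \<inter> F i))"
      using fin \<open>e \<in> F i\<close> by (simp add: Int_insert_left card_insert_if)
    ultimately show ?thesis using i le by (auto simp: T_def)
  qed
  obtain e0 where "e0 \<in> J - Y" using ne Y by auto
  then have "T \<noteq> {}" using blocked by auto
  moreover have finT: "finite T" using finI by (simp add: T_def)
  ultimately have "\<exists>m\<in>F ` T. \<forall>x\<in>F ` T. m \<subseteq> x \<longrightarrow> m = x"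
    by (intro finite_has_maximal) auto
  then obtain i where i: "i \<in> T" and mx: "\<And>j. j \<in> T \<Longrightarrow> F i \<subseteq> F j \<Longrightarrow> F i = F j"
    by blast
  have "F j \<subseteq> F i" if "j \<in> T" for j
    using chain[of i j] mx[OF that] that i by (auto simp: T_def)
  then have "J - Y \<subseteq> F i" using blocked by blast
  then have "Y - F i = J - F i" using Y by blast
  moreover have "card Y = card (Y \<inter> F i) + card (Y - F i)" using fin by (metis card_Int_Diff)
  ultimately show thesis using that[of i] i by (auto simp: T_def)
qed

lemma matroid_capped: "matroid (capped E I F h)"
  unfolding matroid_def
proof (intro conjI ballI allI impI)
  show "finite (ground (capped E I F h))" using finE by simp
  show "indep (capped E I F h) \<subseteq> Pow (ground (capped E I F h))" by (auto simp: indep_capped)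
  show "{} \<in> indep (capped E I F h)" by (auto simp: indep_capped)
next
  fix X J assume XJ: "X \<in> indep (capped E I F h)" "J \<subseteq> X"
  have "card (J \<inter> F i) \<le> card (X \<inter> F i)" for i
    using XJ finE by (intro card_mono) (auto simp: indep_capped intro: finite_subset)
  then show "J \<in> indep (capped E I F h)"
    using XJ unfolding indep_capped by (meson le_trans subset_trans)
next
  fix X J assume XJ: "X \<in> indep (capped E I F h)" "J \<in> indep (capped E I F h)" "card X < card J"
  show "\<exists>e\<in>J - X. insert e X \<in> indep (capped E I F h)"
  proof (rule ccontr)
    assume no: "\<not> ?thesis"
    have sub: "X \<union> J \<subseteq> E" using XJ by (auto simp: indep_capped)
    have "X \<noteq> X \<union> J" using XJ(3) card_mono[of X J] finE sub
      by (metis Un_upper2 finite_subset le_sup_iff leD)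
    then obtain i where "i \<in> I" "card X = h i + card ((X \<union> J) - F i)"
      using capped_maximal_card[OF XJ(1) _ sub] no by blast
    then show False
      using capped_indep_card_le[OF XJ(2) _ sub] XJ(3) by fastforce
  qed
qed

lemma rk_capped_le:
  assumes "J \<subseteq> E" "i \<in> I"
  shows "rk (capped E I F h) J \<le> h i + card (J - F i)"
  by (metis assms capped_indep_card_le matroid_capped rk_attained)

lemma le_rk_capped:
  assumes J: "J \<subseteq> E" and le: "m \<le> card J" "\<And>i. i \<in> I \<Longrightarrow> m \<le> h i + card (J - F i)"
  shows "m \<le> rk (capped E I F h) J"
proof -
  obtain Y where Y: "Y \<in> indep (capped E I F h)" "Y \<subseteq> J" "card Y = rk (capped E I F h) J"
    using rk_attained[OF matroid_capped] .
  have fin: "finite Y" using Y J finE by (meson finite_subset)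
  have max: "insert e Y \<notin> indep (capped E I F h)" if "e \<in> J - Y" for e
    using card_le_rk[OF matroid_capped, of "insert e Y" J] that Y fin by auto
  show ?thesis
  proof (cases "Y = J")
    case False
    then obtain i where "i \<in> I" "card Y = h i + card (J - F i)"
      using capped_maximal_card[OF Y(1,2) J max] by blast
    then show ?thesis using le Y by metis
  qed (use le Y in simp)
qed

text \<open>A circuit exceeds the capacity of some member of the chain. By minimality it lies inside that
member and has at least the rank of that member, so every flat that contains the circuit contains
the member too. Hence a cyclic flat is a union of members of the chain, and such unions are
comparable.\<close>

lemma nested_capped:
  assumes FE: "\<And>i. i \<in> I \<Longrightarrow> F i \<subseteq> E"
  shows "nested (capped E I F h)"
  unfolding nested_def
proof (intro conjI ballI)
  let ?M = "capped E I F h"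
  show M: "matroid ?M" by (rule matroid_capped)
  have members: "\<exists>i\<in>I. x \<in> F i \<and> F i \<subseteq> Z" if Z: "Z \<in> cyclic_flats ?M" "x \<in> Z" for x Z
  proof -
    obtain C where C: "C \<in> circuits ?M" "x \<in> C" "C \<subseteq> Z"
      using Z by (auto simp: cyclic_flats_def)
    have finC: "finite C" and CE: "C \<subseteq> E" using C finE by (auto simp: circuits_def intro: finite_subset)
    obtain i where i: "i \<in> I" "h i < card (C \<inter> F i)"
      using C by (auto simp: circuits_def indep_capped not_le)
    have "C \<inter> F i \<notin> indep ?M" using i by (auto simp: indep_capped intro!: bexI[of _ i])
    then have CF: "C \<subseteq> F i" using C(1) unfolding circuits_def by blast
    have "C - {x} \<in> indep ?M" using C by (auto simp: circuits_def)
    then have "card (C - {x}) \<le> rk ?M C" by (intro card_le_rk[OF M]) auto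
    then have "h i \<le> rk ?M C"
      using i CF finC C by (simp add: Int_absorb2 card_Diff_singleton)
    moreover have "rk ?M (F i) \<le> h i" using rk_capped_le[OF FE[OF i(1)] i(1)] by simp
    ultimately have le: "rk ?M (F i) \<le> rk ?M C" by simp
    have "F i \<subseteq> Z"
    proof (rule ccontr)
      assume "\<not> F i \<subseteq> Z"
      then obtain e where e: "e \<in> F i" "e \<notin> Z" by auto
      have "e \<in> E" using e FE i by auto
      then have lt: "rk ?M Z < rk ?M (insert e Z)"
        using Z e by (auto simp: cyclic_flats_def flats_def)
      have "rk ?M (Z \<union> insert e C) + rk ?M (Z \<inter> insert e C) \<le> rk ?M Z + rk ?M (insert e C)"
        by (rule rk_submodular[OF M])
      moreover have "rk ?M (Z \<union> insert e C) = rk ?M (insert e Z)"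
        using C by (metis Un_insert_right sup.absorb1)
      moreover have "rk ?M C \<le> rk ?M (Z \<inter> insert e C)" using C by (intro rk_mono[OF M]) auto
      moreover have "rk ?M (insert e C) \<le> rk ?M (F i)" using CF e by (intro rk_mono[OF M]) auto
      ultimately show False using lt le by linarith
    qed
    then show ?thesis using i C CF by blast
  qed
  fix Z Z' assume Z: "Z \<in> cyclic_flats ?M" "Z' \<in> cyclic_flats ?M"
  show "Z \<subseteq> Z' \<or> Z' \<subseteq> Z"
  proof (rule ccontr)
    assume "\<not> ?thesis"
    then obtain x y where xy: "x \<in> Z" "x \<notin> Z'" "y \<in> Z'" "y \<notin> Z" by auto
    obtain i j where "i \<in> I" "x \<in> F i" "F i \<subseteq> Z" "j \<in> I" "y \<in> F j" "F j \<subseteq> Z'"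
      using members Z xy by metis
    then show False using chain[of i j] xy by blast
  qed
qed

end

section \<open>Free products of uniform matroids\<close>

lemma rk_uniform_ground:
  assumes "finite S" "a \<le> card S"
  shows "rk (uniform_matroid a S) S = a"
proof -
  obtain T where "T \<subseteq> S" "card T = a" using assms by (meson obtain_subset_with_card_n)
  then show ?thesis
    unfolding rk_def uniform_matroid_def using assms
    by (intro Max_eqI) (auto intro: finite_subset)
qed

text \<open>If \<open>N\<close> is given by capacities on a chain, then its rank is a minimum over the chain, and the
condition \<open>card (I \<union> J) \<le> a m + rk N J\<close> splits into one inequality for each member of the chain.
These are the capacity conditions for the members enlarged by \<open>S m\<close>.\<close>

lemma free_products_uniform_eq_capped:
  fixes S :: "nat \<Rightarrow> 'e::finite set"
  assumes "m \<le> n" and le: "\<And>i. i \<in> {m..n} \<Longrightarrow> a i \<le> card (S i)"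
    and disj: "disjoint_family_on S {m..n}"
  shows "free_products (map (\<lambda>i. uniform_matroid (a i) (S i)) [m..<Suc n]) =
    capped (\<Union>i\<in>{m..n}. S i) {m..n} (\<lambda>i. \<Union>j\<in>{m..i}. S j) (\<lambda>i. \<Sum>j=m..i. a j)"
  using assms
proof (induction m rule: inc_induct)
  case base
  then show ?case by (auto simp: capped_def uniform_matroid_def Int_absorb2)
next
  case (step m)
  let ?F = "\<lambda>m i. \<Union>j\<in>{m..i}. S j" and ?A = "\<lambda>m i. \<Sum>j=m..i. a j"
  let ?N = "capped (\<Union>i\<in>{Suc m..n}. S i) {Suc m..n} (?F (Suc m)) (?A (Suc m))"
  let ?U = "uniform_matroid (a m) (S m)"
  have mn: "m < n" using step by simp
  have IH: "free_products (map (\<lambda>i. uniform_matroid (a i) (S i)) [Suc m..<Suc n]) = ?N"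
    using step.prems by (intro step.IH) (auto simp: disjoint_family_on_def)
  have "free_products (map (\<lambda>i. uniform_matroid (a i) (S i)) [m..<Suc n]) =
      free_product ?U (free_products (map (\<lambda>i. uniform_matroid (a i) (S i)) [Suc m..<Suc n]))"
    using mn by (simp add: upt_conv_Cons del: upt_Suc)
  also have "\<dots> = free_product ?U ?N" unfolding IH ..
  finally have eq: "free_products (map (\<lambda>i. uniform_matroid (a i) (S i)) [m..<Suc n]) =
    free_product ?U ?N" .
  have ivl: "{m..i} = insert m {Suc m..i}" if "m \<le> i" for i using that by auto
  have F: "?F m i = S m \<union> ?F (Suc m) i" and A: "?A m i = a m + ?A (Suc m) i" if "m \<le> i" for i
    using that by (auto simp: ivl)
  have disjm: "S m \<inter> S i = {}" if "i \<in> {Suc m..n}" for i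
    using disjoint_family_onD[OF step.prems(2), of m i] that mn by auto
  have chain: "?F (Suc m) i \<subseteq> ?F (Suc m) j \<or> ?F (Suc m) j \<subseteq> ?F (Suc m) i" for i j
    using UN_mono[of "{Suc m..i}" "{Suc m..j}" S S] UN_mono[of "{Suc m..j}" "{Suc m..i}" S S]
    by (cases "i \<le> j") auto
  have rkU: "rk ?U (ground ?U) = a m"
    using step.prems(1)[of m] mn rk_uniform_ground[of "S m" "a m"] by (simp add: uniform_matroid_def)
  have "indep (free_product ?U ?N) =
    {X. X \<subseteq> \<Union> (S ` {m..n}) \<and> (\<forall>i\<in>{m..n}. card (X \<inter> ?F m i) \<le> ?A m i)}"
  proof (intro set_eqI iffI)
    fix X assume "X \<in> indep (free_product ?U ?N)"
    then obtain I J where X: "X = I \<union> J" and I': "I \<in> indep ?U"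
      and J': "J \<subseteq> ground ?N" and c: "card (I \<union> J) \<le> a m + rk ?N J"
      unfolding free_product_def rkU by (simp only: set_system.sel mem_Collect_eq) metis
    have I: "I \<subseteq> S m" "card I \<le> a m" using I' by (simp_all add: uniform_matroid_def)
    have J: "J \<subseteq> (\<Union>i\<in>{Suc m..n}. S i)" using J' by (simp only: ground_capped)
    have SJ: "S m \<inter> J = {}" using J disjm by blast
    have IJ: "I \<inter> J = {}" using I SJ by blast
    have "card (X \<inter> ?F m i) \<le> ?A m i" if i: "i \<in> {m..n}" for i
    proof (cases "i = m")
      case True
      have "X \<inter> S m = I" using X I SJ by auto
      then show ?thesis using True I by simp
    next
      case False
      have "I \<inter> S j = {}" if "j \<in> {Suc m..i}" for j
        using I(1) disjm[of j] that i by auto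
      then have "I \<inter> ?F (Suc m) i = {}" by blast
      then have "X \<inter> ?F m i = I \<union> (J \<inter> ?F (Suc m) i)"
        using X I SJ F[of i] i by auto
      then have "card (X \<inter> ?F m i) = card I + card (J \<inter> ?F (Suc m) i)"
        using IJ by (metis Int_assoc card_Un_disjoint finite inf_bot_left)
      moreover have "card J = card (J \<inter> ?F (Suc m) i) + card (J - ?F (Suc m) i)"
        by (metis card_Int_Diff finite)
      moreover have "rk ?N J \<le> ?A (Suc m) i + card (J - ?F (Suc m) i)"
        using J i False chain by (intro rk_capped_le) auto
      moreover have "card (I \<union> J) = card I + card J" using IJ by (simp add: card_Un_disjoint)
      moreover have "?A m i = a m + ?A (Suc m) i" using A i by auto
      ultimately show ?thesis using c by linarith
    qed
    moreover have "X \<subseteq> \<Union> (S ` {m..n})" using X I J ivl[of n] mn by auto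
    ultimately show "X \<in> {X. X \<subseteq> \<Union> (S ` {m..n}) \<and> (\<forall>i\<in>{m..n}. card (X \<inter> ?F m i) \<le> ?A m i)}"
      by blast
  next
    fix X assume "X \<in> {X. X \<subseteq> \<Union> (S ` {m..n}) \<and> (\<forall>i\<in>{m..n}. card (X \<inter> ?F m i) \<le> ?A m i)}"
    then have X: "X \<subseteq> \<Union> (S ` {m..n})" and cap: "\<And>i. i \<in> {m..n} \<Longrightarrow> card (X \<inter> ?F m i) \<le> ?A m i"
      by auto
    define I J where "I = X \<inter> S m" and "J = X - S m"
    have cI: "card I \<le> a m" using cap[of m] mn by (simp add: I_def)
    have J: "J \<subseteq> (\<Union>i\<in>{Suc m..n}. S i)" using X ivl[of n] mn by (auto simp: J_def)
    have IJ: "I \<inter> J = {}" by (auto simp: I_def J_def)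
    have "card I + card J - a m \<le> rk ?N J"
    proof (rule le_rk_capped[OF _ _ chain J])
      show "card I + card J - a m \<le> card J" using cI by simp
      fix i assume i: "i \<in> {Suc m..n}"
      have "S m \<inter> ?F (Suc m) i = {}" using disjm i by fastforce
      then have "X \<inter> ?F m i = I \<union> (J \<inter> ?F (Suc m) i)"
        using F[of i] i by (auto simp: I_def J_def)
      then have "card (X \<inter> ?F m i) = card I + card (J \<inter> ?F (Suc m) i)"
        using IJ by (metis Int_assoc card_Un_disjoint finite inf_bot_left)
      moreover have "card J = card (J \<inter> ?F (Suc m) i) + card (J - ?F (Suc m) i)"
        by (metis card_Int_Diff finite)
      moreover have "card (X \<inter> ?F m i) \<le> ?A m i" using cap i by auto
      moreover have "?A m i = a m + ?A (Suc m) i" using A i by auto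
      ultimately show "card I + card J - a m \<le> ?A (Suc m) i + card (J - ?F (Suc m) i)" by linarith
    qed auto
    moreover have "card (I \<union> J) = card I + card J"
      using IJ by (simp add: card_Un_disjoint)
    ultimately have c: "card (I \<union> J) \<le> a m + rk ?N J" by linarith
    have IU: "I \<in> indep ?U" using cI by (auto simp: I_def uniform_matroid_def)
    have JN: "J \<subseteq> ground ?N" using J by (simp only: ground_capped)
    have "I \<union> J \<in> indep (free_product ?U ?N)"
      unfolding free_product_def rkU set_system.sel mem_Collect_eq
      by (rule exI[of _ I], rule exI[of _ J], rule conjI[OF refl conjI[OF IU conjI[OF JN c]]])
    moreover have "X = I \<union> J" by (auto simp: I_def J_def)
    ultimately show "X \<in> indep (free_product ?U ?N)" by metis
  qed
  moreover have "ground (free_product ?U ?N) = \<Union> (S ` {m..n})"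
    using ivl[of n] mn by (simp add: free_product_def uniform_matroid_def)
  ultimately show ?case
    unfolding eq capped_def by (simp add: set_system.expand)
qed

section \<open>The Euler characteristic of compact convex sets\<close>

text \<open>The sum of the coefficients of the intervals through \<open>t\<close>, minus the same sum slightly to the right
of \<open>t\<close>, is the sum over the intervals that end at \<open>t\<close>.\<close>

lemma sum_intervals_eq_0:
  fixes l u c :: "'j \<Rightarrow> real"
  assumes fin: "finite J" and lu: "\<And>j. j \<in> J \<Longrightarrow> l j \<le> u j"
    and zero: "\<And>t. (\<Sum>j | j \<in> J \<and> l j \<le> t \<and> t \<le> u j. c j) = 0"
  shows "sum c J = 0"
proof -
  have ends: "(\<Sum>j | j \<in> J \<and> u j = t. c j) = 0" for t
  proof -
    let ?E = "{x \<in> l ` J \<union> u ` J. t < x}"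
    have finE: "finite ?E" using fin by simp
    obtain s where s: "t < s" "\<And>x. x \<in> ?E \<Longrightarrow> s < x"
    proof (cases "?E = {}")
      case True
      show thesis by (rule that[of "t + 1"]) (use True in auto)
    next
      case False
      have "t < Min ?E" using Min_in[OF finE False] by blast
      then obtain s where s: "t < s" "s < Min ?E" using dense by blast
      show thesis
      proof (rule that[of s])
        fix x assume "x \<in> ?E"
        then show "s < x" using Min_le[OF finE] s(2) by fastforce
      qed (rule s(1))
    qed
    have "{j. j \<in> J \<and> l j \<le> t \<and> t \<le> u j} =
        {j. j \<in> J \<and> l j \<le> s \<and> s \<le> u j} \<union> {j. j \<in> J \<and> u j = t}"
    proof (intro set_eqI)
      fix j
      show "j \<in> {j. j \<in> J \<and> l j \<le> t \<and> t \<le> u j} \<longleftrightarrow>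
        j \<in> {j. j \<in> J \<and> l j \<le> s \<and> s \<le> u j} \<union> {j. j \<in> J \<and> u j = t}"
        using s(1) s(2)[of "l j"] s(2)[of "u j"] lu[of j] by force
    qed
    moreover have "(\<Sum>j\<in>{j. j \<in> J \<and> l j \<le> s \<and> s \<le> u j} \<union> {j. j \<in> J \<and> u j = t}. c j) =
        (\<Sum>j | j \<in> J \<and> l j \<le> s \<and> s \<le> u j. c j) + (\<Sum>j | j \<in> J \<and> u j = t. c j)"
      using fin s(1) by (intro sum.union_disjoint) auto
    ultimately show ?thesis using zero[of t] zero[of s] by simp
  qed
  have "sum c J = (\<Sum>t\<in>u ` J. \<Sum>j | j \<in> J \<and> u j = t. c j)"
    by (rule sum.image_gen[OF fin])
  then show ?thesis using ends by simp
qed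

text \<open>Assigning \<open>1\<close> to each nonempty compact convex set respects all linear relations between indicator
functions, as the Euler characteristic does. Slices orthogonal to one coordinate axis reduce the
dimension by one: the values of that coordinate for which the slice is nonempty form a compact
interval.\<close>

lemma sum_compact_convex_nonempty_eq_0:
  fixes K :: "'j \<Rightarrow> (real ^ 'e::finite) set" and c :: "'j \<Rightarrow> real"
  assumes fin: "finite J" and cpt: "\<And>j. j \<in> J \<Longrightarrow> compact (K j)"
    and cvx: "\<And>j. j \<in> J \<Longrightarrow> convex (K j)"
    and zero: "\<And>x. (\<Sum>j | j \<in> J \<and> x \<in> K j. c j) = 0"
  shows "(\<Sum>j | j \<in> J \<and> K j \<noteq> {}. c j) = 0"
proof -
  \<comment> \<open>Only the coordinates in \<open>D\<close> are free in a slice; \<open>D\<close> grows from the empty set to \<open>UNIV\<close>.\<close>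
  define slice where "slice D y = {x::real ^ 'e. \<forall>i. i \<notin> D \<longrightarrow> x $ i = y $ i}" for D y
  have closed_slice: "closed (slice D y)" for D y
  proof -
    have "slice D y = (\<Inter>i\<in>-D. {x. x $ i = y $ i})" by (auto simp: slice_def)
    moreover have "closed {x::real ^ 'e. x $ i = y $ i}" for i
      by (intro closed_Collect_eq continuous_intros)
    ultimately show ?thesis by auto
  qed
  have convex_slice: "convex (slice D y)" for D y
    unfolding slice_def convex_def by (auto simp flip: distrib_right)
  have "\<forall>y. (\<Sum>j | j \<in> J \<and> K j \<inter> slice D y \<noteq> {}. c j) = 0" if "finite D" for D
    using that
  proof (induction D rule: finite_induct)
    case empty
    have "slice {} y = {y}" for y by (auto simp: slice_def vec_eq_iff)
    then show ?case using zero by simp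
  next
    case (insert d D)
    show ?case
    proof
      fix y
      let ?S = "\<lambda>j. K j \<inter> slice (insert d D) y"
      define J' where "J' = {j. j \<in> J \<and> ?S j \<noteq> {}}"
      define P where "P j = (\<lambda>x. x $ d) ` ?S j" for j
      have "\<exists>l u. l \<le> u \<and> P j = {l..u}" if "j \<in> J'" for j
      proof -
        have J: "j \<in> J" and ne: "P j \<noteq> {}" using that by (auto simp: J'_def P_def)
        have "compact (P j)" unfolding P_def
          using cpt[OF J] closed_slice
          by (intro compact_continuous_image continuous_intros compact_Int_closed) auto
        moreover have "connected (P j)" unfolding P_def
          using cvx[OF J] convex_slice
          by (intro connected_continuous_image continuous_intros convex_connected convex_Int) auto
        ultimately obtain l u where "P j = {l..u}"
          by (metis connected_compact_interval_1 interval_cbox)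
        then show ?thesis using ne by auto
      qed
      then obtain l u where lu: "\<And>j. j \<in> J' \<Longrightarrow> l j \<le> u j" "\<And>j. j \<in> J' \<Longrightarrow> P j = {l j..u j}"
        by metis
      have mem: "t \<in> P j \<longleftrightarrow> K j \<inter> slice D (\<chi> i. if i = d then t else y $ i) \<noteq> {}" for t j
      proof
        assume "t \<in> P j"
        then obtain x where "x \<in> K j" "x \<in> slice (insert d D) y" "x $ d = t"
          by (auto simp: P_def)
        then have "x \<in> K j \<inter> slice D (\<chi> i. if i = d then t else y $ i)"
          by (auto simp: slice_def)
        then show "K j \<inter> slice D (\<chi> i. if i = d then t else y $ i) \<noteq> {}" by blast
      next
        assume "K j \<inter> slice D (\<chi> i. if i = d then t else y $ i) \<noteq> {}"
        then obtain x where x: "x \<in> K j" "x \<in> slice D (\<chi> i. if i = d then t else y $ i)" by auto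
        then have "x \<in> ?S j" "x $ d = t" using insert.hyps by (auto simp: slice_def)
        then show "t \<in> P j" by (auto simp: P_def)
      qed
      have "sum c J' = 0"
      proof (rule sum_intervals_eq_0[of J' l u c])
        show "finite J'" using fin by (simp add: J'_def)
        fix t
        have "{j. j \<in> J' \<and> l j \<le> t \<and> t \<le> u j} = {j. j \<in> J' \<and> t \<in> P j}" using lu by auto
        also have "\<dots> = {j. j \<in> J \<and> t \<in> P j}" by (auto simp: J'_def P_def)
        finally show "(\<Sum>j | j \<in> J' \<and> l j \<le> t \<and> t \<le> u j. c j) = 0"
          using insert.IH mem by simp
      qed (use lu in auto)
      then show "(\<Sum>j | j \<in> J \<and> ?S j \<noteq> {}. c j) = 0" by (simp add: J'_def)
    qed
  qed
  from this[of UNIV] show ?thesis by (simp add: slice_def)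
qed

text \<open>Moebius inversion: the sums over the up-sets \<open>{l. \<rho> \<le> q l}\<close> determine the sums over the fibres of
\<open>q\<close>, by induction from the largest values downwards. It turns information on events
\<open>\<rho> \<le> q l\<close> into information on arbitrary functions of \<open>q l\<close>.\<close>

lemma sum_fibre_function_eq_0:
  fixes q :: "'l \<Rightarrow> 'b::order" and c :: "'l \<Rightarrow> real"
  assumes fin: "finite L" and zero: "\<And>\<rho>. (\<Sum>l | l \<in> L \<and> \<rho> \<le> q l. c l) = 0"
  shows "(\<Sum>l\<in>L. c l * G (q l)) = 0"
proof -
  have fibre: "(\<Sum>l | l \<in> L \<and> q l = \<rho>. c l) = 0" for \<rho>
  proof (induction "card {l \<in> L. \<rho> \<le> q l}" arbitrary: \<rho> rule: less_induct)
    case less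
    show ?case
    proof (cases "\<exists>l\<in>L. q l = \<rho>")
      case True
      then obtain l0 where l0: "l0 \<in> L" "q l0 = \<rho>" by blast
      let ?L = "{l. l \<in> L \<and> \<rho> < q l}"
      have "(\<Sum>l\<in>?L. c l) = (\<Sum>\<rho>'\<in>q ` ?L. \<Sum>l | l \<in> ?L \<and> q l = \<rho>'. c l)"
        using fin by (intro sum.image_gen) auto
      also have "\<dots> = 0"
      proof (rule sum.neutral, rule ballI)
        fix \<rho>' assume "\<rho>' \<in> q ` ?L"
        then have lt: "\<rho> < \<rho>'" by auto
        then have "{l. l \<in> ?L \<and> q l = \<rho>'} = {l. l \<in> L \<and> q l = \<rho>'}" by auto
        moreover have "card {l \<in> L. \<rho>' \<le> q l} < card {l \<in> L. \<rho> \<le> q l}"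
        proof (intro psubset_card_mono psubsetI)
          have "l0 \<in> {l \<in> L. \<rho> \<le> q l} - {l \<in> L. \<rho>' \<le> q l}" using l0 lt by auto
          then show "{l \<in> L. \<rho>' \<le> q l} \<noteq> {l \<in> L. \<rho> \<le> q l}" by blast
        qed (use fin lt in auto)
        ultimately show "(\<Sum>l | l \<in> ?L \<and> q l = \<rho>'. c l) = 0" using less[of \<rho>'] by simp
      qed
      finally have "(\<Sum>l\<in>?L. c l) = 0" .
      moreover have "{l. l \<in> L \<and> \<rho> \<le> q l} = {l. l \<in> L \<and> q l = \<rho>} \<union> ?L" by auto
      then have "(\<Sum>l | l \<in> L \<and> \<rho> \<le> q l. c l) = (\<Sum>l | l \<in> L \<and> q l = \<rho>. c l) + (\<Sum>l\<in>?L. c l)"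
        using fin by (simp only:) (intro sum.union_disjoint; auto)
      ultimately show ?thesis using zero[of \<rho>] by simp
    next
      case False
      then have "{l. l \<in> L \<and> q l = \<rho>} = {}" by auto
      then show ?thesis by (simp only: sum.empty)
    qed
  qed
  have "(\<Sum>l\<in>L. c l * G (q l)) = (\<Sum>\<rho>\<in>q ` L. \<Sum>l | l \<in> L \<and> q l = \<rho>. c l * G (q l))"
    by (rule sum.image_gen[OF fin])
  also have "\<dots> = (\<Sum>\<rho>\<in>q ` L. (\<Sum>l | l \<in> L \<and> q l = \<rho>. c l) * G \<rho>)"
    by (simp add: sum_distrib_right)
  finally show ?thesis using fibre by simp
qed

section \<open>Complete flags\<close>

text \<open>An arbitrary but fixed enumeration of the ground set. Relative to it every complete flag of sets
comes from exactly one permutation, so that sums over flags match the sum over permutations in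
\<^const>\<open>sym_indicator\<close>.\<close>

definition label :: "'e::finite \<Rightarrow> nat" where
  "label = (SOME f. bij_betw f UNIV {..<CARD('e)})"

lemma bij_betw_label: "bij_betw label (UNIV :: 'e::finite set) {..<CARD('e)}"
proof -
  have "\<exists>f. bij_betw f (UNIV :: 'e set) {..<CARD('e)}"
    using ex_bij_betw_finite_nat[of "UNIV :: 'e set"] by (simp add: atLeast0LessThan)
  then show ?thesis unfolding label_def by (rule someI_ex)
qed

definition flag :: "('e::finite \<Rightarrow> 'e) \<Rightarrow> nat \<Rightarrow> 'e set" where
  "flag \<sigma> t = {e. label (\<sigma> e) < t}"

lemma flag_mono: "s \<le> t \<Longrightarrow> flag \<sigma> s \<subseteq> flag \<sigma> t"
  by (auto simp: flag_def)

lemma flag_full: "CARD('e) \<le> t \<Longrightarrow> flag \<sigma> t = (UNIV :: 'e::finite set)"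
  unfolding flag_def using bij_betw_apply[OF bij_betw_label UNIV_I]
  by (auto intro: less_le_trans)

lemma card_flag:
  fixes \<sigma> :: "'e::finite \<Rightarrow> 'e"
  assumes "\<sigma> permutes UNIV" "t \<le> CARD('e)"
  shows "card (flag \<sigma> t) = t"
proof -
  have bij: "bij_betw (label \<circ> \<sigma>) UNIV {..<CARD('e)}"
    using assms bij_betw_label by (auto intro: bij_betw_trans permutes_bij)
  have "(label \<circ> \<sigma>) ` flag \<sigma> t = {..<t}"
  proof
    show "{..<t} \<subseteq> (label \<circ> \<sigma>) ` flag \<sigma> t"
    proof
      fix x assume x: "x \<in> {..<t}"
      then have "x \<in> (label \<circ> \<sigma>) ` UNIV"
        using assms bij by (auto simp: bij_betw_def)
      then show "x \<in> (label \<circ> \<sigma>) ` flag \<sigma> t" using x by (auto simp: flag_def)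
    qed
  qed (auto simp: flag_def)
  moreover have "inj_on (label \<circ> \<sigma>) (flag \<sigma> t)"
    using bij by (auto simp: bij_betw_def intro: inj_on_subset)
  ultimately show ?thesis by (metis card_image card_lessThan)
qed

text \<open>The elements are sorted by the number of chain members that avoid them; each chain member is then
an initial segment.\<close>

lemma ex_flag_through_chain:
  fixes \<C> :: "'e::finite set set"
  assumes chain: "\<And>X Y. X \<in> \<C> \<Longrightarrow> Y \<in> \<C> \<Longrightarrow> X \<subseteq> Y \<or> Y \<subseteq> X"
  obtains \<sigma> where "\<sigma> permutes UNIV" "\<And>X. X \<in> \<C> \<Longrightarrow> flag \<sigma> (card X) = X"
proof -
  define key where "key e = card {X \<in> \<C>. e \<notin> X}" for e
  obtain xs0 :: "'e list" where xs0: "set xs0 = UNIV" "distinct xs0"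
    using finite_distinct_list[of "UNIV :: 'e set"] by auto
  define xs where "xs = sort_key key xs0"
  have xs: "set xs = UNIV" "distinct xs" "sorted (map key xs)"
    using xs0 by (simp_all add: xs_def)
  then have len: "length xs = CARD('e)" by (metis distinct_card)
  have bijx: "bij_betw ((!) xs) {..<CARD('e)} UNIV"
    using bij_betw_nth[OF xs(2), of "{..<CARD('e)}" UNIV] xs len by simp
  define g where "g = the_inv_into {..<CARD('e)} ((!) xs)"
  have bijg: "bij_betw g UNIV {..<CARD('e)}"
    unfolding g_def by (rule bij_betw_the_inv_into[OF bijx])
  have nth_g: "xs ! g e = e" for e
    unfolding g_def using bijx by (auto simp: bij_betw_def intro: f_the_inv_into_f)
  have g_len: "g e < length xs" for e using bij_betw_apply[OF bijg, of e] len by simp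
  have mono: "g e < g e'" if X: "X \<in> \<C>" "e \<in> X" "e' \<notin> X" for X e e'
  proof (rule ccontr)
    assume "\<not> g e < g e'"
    then have "key e' \<le> key e"
      using sorted_nth_mono[OF xs(3), of "g e'" "g e"] g_len nth_g by simp
    moreover have "key e < key e'" unfolding key_def
    proof (intro psubset_card_mono psubsetI)
      show "{X \<in> \<C>. e \<notin> X} \<subseteq> {X \<in> \<C>. e' \<notin> X}" using chain X by blast
      show "{X \<in> \<C>. e \<notin> X} \<noteq> {X \<in> \<C>. e' \<notin> X}" using X by blast
    qed simp
    ultimately show False by simp
  qed
  have seg: "g e < card X \<longleftrightarrow> e \<in> X" if X: "X \<in> \<C>" for X e
  proof
    have inj: "inj_on g X" using bijg by (auto simp: bij_betw_def intro: inj_on_subset)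
    assume lt: "g e < card X"
    show "e \<in> X"
    proof (rule ccontr)
      assume "e \<notin> X"
      then have "g ` X \<subseteq> {..<g e}" using mono X by auto
      then have "card (g ` X) \<le> card {..<g e}" by (intro card_mono) auto
      then show False using lt inj by (simp add: card_image)
    qed
  next
    have inj: "inj_on g X" using bijg by (auto simp: bij_betw_def intro: inj_on_subset)
    assume e: "e \<in> X"
    have "{..g e} \<subseteq> g ` X"
    proof
      fix i assume i: "i \<in> {..g e}"
      then have "i \<in> g ` UNIV" using bijg g_len[of e] len by (auto simp: bij_betw_def)
      then obtain e' where e': "i = g e'" by auto
      then have "e' \<in> X" using mono[OF X e, of e'] i by force
      then show "i \<in> g ` X" using e' by simp
    qed
    then have "card {..g e} \<le> card (g ` X)" by (intro card_mono) auto
    then show "g e < card X" using inj by (simp add: card_image)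
  qed
  define \<sigma> :: "'e \<Rightarrow> 'e" where "\<sigma> = the_inv_into UNIV label \<circ> g"
  have "bij \<sigma>"
    unfolding \<sigma>_def by (rule bij_betw_trans[OF bijg bij_betw_the_inv_into[OF bij_betw_label]])
  then have "\<sigma> permutes UNIV" by (intro bij_imp_permutes) auto
  moreover have "label (\<sigma> e) = g e" for e
    unfolding \<sigma>_def comp_def using bij_betw_label bijg
    by (intro f_the_inv_into_f) (auto simp: bij_betw_def)
  then have "flag \<sigma> (card X) = X" if "X \<in> \<C>" for X
    using seg[OF that] by (auto simp: flag_def)
  ultimately show thesis using that by blast
qed

section \<open>Flag ranks are linear in the symmetrized indicator function\<close>

text \<open>Greedy choice: a basis of one member of the chain extends to a basis of the next.\<close>

lemma ex_base_spanning_chain: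
  fixes X :: "nat \<Rightarrow> 'a set"
  assumes M: "matroid M" and mono: "\<And>s t. s \<le> t \<Longrightarrow> X s \<subseteq> X t" and top: "X n = ground M"
  obtains B where "B \<in> bases M" "\<And>t. t \<le> n \<Longrightarrow> card (B \<inter> X t) = rk M (X t)"
proof -
  have "\<exists>B\<in>indep M. B \<subseteq> X t \<and> (\<forall>s\<le>t. card (B \<inter> X s) = rk M (X s))" for t
  proof (induction t)
    case 0
    obtain B where "B \<in> indep M" "B \<subseteq> X 0" "card B = rk M (X 0)" using rk_attained[OF M] .
    then show ?case by (auto simp: Int_absorb2)
  next
    case (Suc t)
    then obtain B where B: "B \<in> indep M" "B \<subseteq> X t" "\<And>s. s \<le> t \<Longrightarrow> card (B \<inter> X s) = rk M (X s)"
      by blast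
    have "B \<subseteq> X (Suc t)" using B(2) mono[of t "Suc t"] by auto
    then obtain C where C: "C \<in> indep M" "B \<subseteq> C" "C \<subseteq> X (Suc t)" "card C = rk M (X (Suc t))"
      using indep_extends_to_rk[OF M B(1)] by metis
    have "card (C \<inter> X s) = rk M (X s)" if "s \<le> Suc t" for s
    proof (cases "s = Suc t")
      case False
      have "card (C \<inter> X s) \<le> rk M (X s)"
        by (intro card_le_rk[OF M] matroid_indep_subset[OF M C(1)]) auto
      moreover have "card (B \<inter> X s) \<le> card (C \<inter> X s)"
        using C(2) matroid_indep_finite[OF M C(1)] by (intro card_mono) auto
      ultimately show ?thesis using B(3)[of s] that False by simp
    qed (use C in \<open>simp add: Int_absorb2\<close>)
    then show ?case using C by blast
  qed
  then obtain B where B: "B \<in> indep M" "B \<subseteq> X n" "\<And>s. s \<le> n \<Longrightarrow> card (B \<inter> X s) = rk M (X s)"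
    by blast
  have "card B = rk M (ground M)" using B(2) B(3)[of n] by (simp add: Int_absorb2 top)
  then show thesis using that base_if_card_eq_rk[OF M B(1)] B by blast
qed

lemma inner_char_vec: "char_vec X \<bullet> x = (\<Sum>e\<in>X. x $ e)"
proof -
  have "char_vec X \<bullet> x = (\<Sum>e\<in>UNIV. indicator X e * x $ e)"
    by (simp add: inner_vec_def char_vec_def)
  also have "\<dots> = (\<Sum>e\<in>X. x $ e)"
    by (rule sum.mono_neutral_cong_right) (auto simp: indicator_def)
  finally show ?thesis .
qed

lemma sum_char_vec: "(\<Sum>e\<in>X. char_vec B $ e) = card (B \<inter> X)" for X B :: "'e::finite set"
  by (simp add: char_vec_def indicator_def sum.If_cases Int_commute)

text \<open>The coordinates of a point of the polytope sum to at most \<open>rk M Y\<close> over each set \<open>Y\<close>, and a single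
basis attains this bound on all members of a chain at once.\<close>

lemma matroid_polytope_meets_halfspaces_iff:
  fixes X :: "nat \<Rightarrow> 'e::finite set"
  assumes M: "matroid M" "ground M = UNIV"
    and mono: "\<And>s t. s \<le> t \<Longrightarrow> X s \<subseteq> X t" and top: "X n = UNIV"
  shows "(\<exists>x\<in>matroid_polytope M. \<forall>t. real (\<rho> t) \<le> (\<Sum>e\<in>X t. x $ e)) \<longleftrightarrow>
    (\<forall>t. \<rho> t \<le> rk M (X t))"
proof
  assume "\<exists>x\<in>matroid_polytope M. \<forall>t. real (\<rho> t) \<le> (\<Sum>e\<in>X t. x $ e)"
  then obtain x where x: "x \<in> matroid_polytope M" "\<And>t. real (\<rho> t) \<le> (\<Sum>e\<in>X t. x $ e)" by blast
  have "(\<Sum>e\<in>Y. x $ e) \<le> rk M Y" for Y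
  proof -
    have "matroid_polytope M \<subseteq> {x. char_vec Y \<bullet> x \<le> rk M Y}"
      unfolding matroid_polytope_def
    proof (rule hull_minimal)
      show "char_vec ` bases M \<subseteq> {x. char_vec Y \<bullet> x \<le> rk M Y}"
        using card_le_rk[OF M(1) matroid_indep_subset[OF M(1) _ Int_lower1] Int_lower2]
        by (auto simp: inner_char_vec sum_char_vec bases_def)
    qed (rule convex_halfspace_le)
    then show ?thesis using x by (auto simp: inner_char_vec)
  qed
  then show "\<forall>t. \<rho> t \<le> rk M (X t)" using x(2) by (meson of_nat_le_iff order_trans)
next
  assume le: "\<forall>t. \<rho> t \<le> rk M (X t)"
  obtain B where B: "B \<in> bases M" "\<And>t. t \<le> n \<Longrightarrow> card (B \<inter> X t) = rk M (X t)"
    by (rule ex_base_spanning_chain[of M X n]) (use M mono top in auto)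
  have "card (B \<inter> X t) = rk M (X t)" for t
  proof (cases "t \<le> n")
    case False
    then have "X t = X n" using mono[of n t] top by auto
    then show ?thesis using B(2)[of n] by simp
  qed (use B in simp)
  then have "\<forall>t. real (\<rho> t) \<le> (\<Sum>e\<in>X t. char_vec B $ e)" using le by (simp add: sum_char_vec)
  moreover have "char_vec B \<in> matroid_polytope M"
    using B by (auto simp: matroid_polytope_def intro: hull_inc)
  ultimately show "\<exists>x\<in>matroid_polytope M. \<forall>t. real (\<rho> t) \<le> (\<Sum>e\<in>X t. x $ e)" by blast
qed

text \<open>As \<open>G\<close> varies, these numbers carry the information of Derksen's \<open>\<G>\<close>-invariant, the distribution of
the rank sequence along a random complete flag.\<close>

definition flag_sum :: "((nat \<Rightarrow> nat) \<Rightarrow> real) \<Rightarrow> 'e::finite set_system \<Rightarrow> real" where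
  "flag_sum G M = (\<Sum>\<sigma> | \<sigma> permutes UNIV. G (\<lambda>t. rk M (flag \<sigma> t)))"

lemma linear_permute_coords: "linear (\<lambda>y::real ^ 'e::finite. \<chi> i. y $ f i)"
  by (rule linearI) (simp_all add: vec_eq_iff)

lemma permuted_coords_vimage:
  fixes P :: "(real ^ 'e::finite) set"
  assumes "bij f"
  shows "{x. (\<chi> i. x $ f i) \<in> P} = (\<lambda>y. \<chi> i. y $ inv f i) ` P"
proof (intro set_eqI iffI)
  fix x assume "x \<in> {x. (\<chi> i. x $ f i) \<in> P}"
  then show "x \<in> (\<lambda>y. \<chi> i. y $ inv f i) ` P"
    using assms by (intro image_eqI[of _ _ "\<chi> i. x $ f i"]) (auto simp: bij_is_surj surj_f_inv_f)
qed (use assms in \<open>auto simp: bij_is_inj\<close>)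

text \<open>The condition that the ranks along a given flag are at least \<open>\<rho>\<close> says that a compact convex set is
nonempty, namely the polytope cut by one halfspace for each member of the flag. Since passing to
nonemptiness respects linear relations, so does the count of permutations that satisfy the
condition, and Moebius inversion extends this to all functions \<open>G\<close> of the rank sequence.\<close>

lemma flag_sum_linear:
  fixes Ms :: "'j \<Rightarrow> 'e::finite set_system"
  assumes fin: "finite J" and Ms: "\<And>j. j \<in> J \<Longrightarrow> matroid (Ms j)" "\<And>j. j \<in> J \<Longrightarrow> ground (Ms j) = UNIV"
    and zero: "\<And>x. (\<Sum>j\<in>J. c j * sym_indicator (matroid_polytope (Ms j)) x) = 0"
  shows "(\<Sum>j\<in>J. c j * flag_sum G (Ms j)) = 0"
proof -
  let ?Pm = "{\<sigma>. \<sigma> permutes (UNIV :: 'e set)}"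
  let ?X = "\<lambda>t. {e::'e. label e < t}"
  have finPm: "finite ?Pm" by (simp add: finite_permutations)
  define K :: "'j \<times> ('e \<Rightarrow> 'e) \<Rightarrow> (real ^ 'e) set" where "K = (\<lambda>(j, \<sigma>). {x. (\<chi> i. x $ \<sigma> i) \<in> matroid_polytope (Ms j)})"
  have ranks: "(\<Sum>l | l \<in> J \<times> ?Pm \<and> \<rho> \<le> (\<lambda>t. rk (Ms (fst l)) (flag (snd l) t)). c (fst l)) = 0"
    for \<rho> :: "nat \<Rightarrow> nat"
  proof -
    define H where "H = {x::real ^ 'e. \<forall>t. real (\<rho> t) \<le> (\<Sum>e\<in>?X t. x $ e)}"
    have H: "H = (\<Inter>t. {x. char_vec (?X t) \<bullet> x \<ge> real (\<rho> t)})"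
      by (auto simp: H_def inner_char_vec)
    have clH: "closed H" unfolding H by (intro closed_INT ballI closed_halfspace_ge)
    have cvH: "convex H" unfolding H by (intro convex_INT convex_halfspace_ge)
    have "(\<Sum>l | l \<in> J \<times> ?Pm \<and> K l \<inter> H \<noteq> {}. c (fst l)) = 0"
    proof (rule sum_compact_convex_nonempty_eq_0)
      show "finite (J \<times> ?Pm)" using fin finPm by simp
    next
      fix l assume l: "l \<in> J \<times> ?Pm"
      then obtain j \<sigma> where jl: "l = (j, \<sigma>)" "j \<in> J" "\<sigma> permutes UNIV" by auto
      then have Kl: "K l = (\<lambda>y. \<chi> i. y $ inv \<sigma> i) ` matroid_polytope (Ms j)"
        unfolding K_def by (simp add: permuted_coords_vimage permutes_bij)
      have "compact (matroid_polytope (Ms j))"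
        unfolding matroid_polytope_def by (intro compact_convex_hull finite_imp_compact) simp
      then have "compact (K l)"
        unfolding Kl by (intro compact_continuous_image linear_continuous_on
            linear_conv_bounded_linear[THEN iffD1] linear_permute_coords)
      then show "compact (K l \<inter> H)" using clH by (rule compact_Int_closed)
      have "convex (K l)"
        unfolding Kl by (intro convex_linear_image linear_permute_coords)
          (simp add: matroid_polytope_def)
      then show "convex (K l \<inter> H)" using cvH by (rule convex_Int)
    next
      fix x
      show "(\<Sum>l | l \<in> J \<times> ?Pm \<and> x \<in> K l \<inter> H. c (fst l)) = 0"
      proof (cases "x \<in> H")
        case True
        have "(\<Sum>l | l \<in> J \<times> ?Pm \<and> x \<in> K l \<inter> H. c (fst l)) =
            (\<Sum>l\<in>J \<times> ?Pm. if x \<in> K l then c (fst l) else 0)"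
          using True fin finPm by (intro sum.mono_neutral_cong_left) auto
        also have "\<dots> = (\<Sum>j\<in>J. \<Sum>\<sigma>\<in>?Pm. if x \<in> K (j, \<sigma>) then c j else 0)"
          by (simp add: sum.cartesian_product case_prod_unfold)
        also have "\<dots> = (\<Sum>j\<in>J. c j *
            (\<Sum>\<sigma>\<in>?Pm. indicator (matroid_polytope (Ms j)) (\<chi> i. x $ \<sigma> i)))"
          unfolding sum_distrib_left
          by (intro sum.cong refl) (auto simp: K_def indicator_def)
        also have "\<dots> = (\<Sum>j\<in>J. fact CARD('e) * (c j * sym_indicator (matroid_polytope (Ms j)) x))"
          by (simp add: sym_indicator_def)
        also have "\<dots> = 0" using zero[of x] by (simp flip: sum_distrib_left)
        finally show ?thesis .
      qed simp
    qed
    moreover have "K l \<inter> H \<noteq> {} \<longleftrightarrow> \<rho> \<le> (\<lambda>t. rk (Ms (fst l)) (flag (snd l) t))"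
      if l: "l \<in> J \<times> ?Pm" for l
    proof -
      obtain j \<sigma> where jl: "l = (j, \<sigma>)" "j \<in> J" "\<sigma> permutes UNIV" using l by auto
      \<comment> \<open>Permuting the coordinates moves the fixed flag \<open>?X\<close> to the flag of \<open>\<sigma>\<close>.\<close>
      have sum_flag: "(\<Sum>e\<in>?X t. x $ e) = (\<Sum>e\<in>flag \<sigma> t. x $ \<sigma> e)" for x :: "real ^ 'e" and t
        using jl(3) by (intro sum.reindex_bij_witness[of _ \<sigma> "inv \<sigma>"])
          (auto simp: flag_def permutes_inverses)
      have "K l \<inter> H \<noteq> {} \<longleftrightarrow>
          (\<exists>y\<in>matroid_polytope (Ms j). \<forall>t. real (\<rho> t) \<le> (\<Sum>e\<in>flag \<sigma> t. y $ e))"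
      proof
        assume "K l \<inter> H \<noteq> {}"
        then obtain x where "x \<in> K l" "x \<in> H" by auto
        then show "\<exists>y\<in>matroid_polytope (Ms j). \<forall>t. real (\<rho> t) \<le> (\<Sum>e\<in>flag \<sigma> t. y $ e)"
          by (intro bexI[of _ "\<chi> i. x $ \<sigma> i"]) (auto simp: K_def H_def jl sum_flag)
      next
        assume "\<exists>y\<in>matroid_polytope (Ms j). \<forall>t. real (\<rho> t) \<le> (\<Sum>e\<in>flag \<sigma> t. y $ e)"
        then obtain y where y: "y \<in> matroid_polytope (Ms j)"
          "\<forall>t. real (\<rho> t) \<le> (\<Sum>e\<in>flag \<sigma> t. y $ e)" by blast
        have "(\<chi> i. (\<chi> e. y $ inv \<sigma> e) $ \<sigma> i) = y"
          using jl(3) by (simp add: vec_eq_iff permutes_inverses)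
        then have "(\<chi> e. y $ inv \<sigma> e) \<in> K l \<inter> H"
          using y jl(3) by (simp add: K_def H_def jl(1) sum_flag permutes_inverses)
        then show "K l \<inter> H \<noteq> {}" by blast
      qed
      also have "\<dots> \<longleftrightarrow> (\<forall>t. \<rho> t \<le> rk (Ms j) (flag \<sigma> t))"
        by (rule matroid_polytope_meets_halfspaces_iff[of "Ms j" "flag \<sigma>" "CARD('e)"])
          (use Ms jl in \<open>simp_all add: flag_mono flag_full\<close>)
      finally show ?thesis by (simp add: jl le_fun_def)
    qed
    ultimately show ?thesis by (simp cong: conj_cong)
  qed
  have "(\<Sum>l\<in>J \<times> ?Pm. c (fst l) * G (\<lambda>t. rk (Ms (fst l)) (flag (snd l) t))) = 0"
    using fin finPm ranks
    by (intro sum_fibre_function_eq_0[where q = "\<lambda>l t. rk (Ms (fst l)) (flag (snd l) t)"]) auto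
  then show ?thesis
    unfolding flag_sum_def sum_distrib_left by (simp add: sum.cartesian_product case_prod_unfold)
qed

section \<open>Relabelling the ground set\<close>

definition relabel :: "('a \<Rightarrow> 'b) \<Rightarrow> 'a set_system \<Rightarrow> 'b set_system" where
  "relabel f M = Set_System (f ` ground M) ((`) f ` indep M)"

lemma matroid_relabel:
  assumes "inj f" "matroid M"
  shows "matroid (relabel f M)"
  unfolding matroid_def
proof (intro conjI ballI allI impI)
  show "finite (ground (relabel f M))" using assms by (simp add: relabel_def matroid_def)
  show "indep (relabel f M) \<subseteq> Pow (ground (relabel f M))"
    using assms by (auto simp: relabel_def matroid_def)
  show "{} \<in> indep (relabel f M)"
    using assms by (auto simp: relabel_def matroid_def)
next
  fix I J assume "I \<in> indep (relabel f M)" "J \<subseteq> I"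
  then show "J \<in> indep (relabel f M)"
    using matroid_indep_subset[OF assms(2)] by (auto simp: relabel_def subset_image_iff)
next
  fix I J assume IJ: "I \<in> indep (relabel f M)" "J \<in> indep (relabel f M)" "card I < card J"
  then obtain I' J' where IJ': "I = f ` I'" "J = f ` J'" "I' \<in> indep M" "J' \<in> indep M"
    by (auto simp: relabel_def)
  then have "card I' < card J'"
    using IJ(3) assms(1) by (simp add: card_image inj_on_subset)
  then obtain e where "e \<in> J' - I'" "insert e I' \<in> indep M"
    using matroid_augment[OF assms(2)] IJ' by blast
  then have "f e \<in> J - I" "f ` insert e I' \<in> indep (relabel f M)"
    using IJ' assms(1) by (auto simp: relabel_def inj_image_mem_iff simp del: image_insert)
  then show "\<exists>e\<in>J - I. insert e I \<in> indep (relabel f M)"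
    using IJ' by auto
qed

lemma rk_relabel:
  assumes "inj f"
  shows "rk (relabel f M) (f ` X) = rk M X"
proof -
  have "{I \<in> indep (relabel f M). I \<subseteq> f ` X} = (`) f ` {I \<in> indep M. I \<subseteq> X}"
    using assms by (auto simp: relabel_def inj_image_subset_iff)
  then have "card ` {I \<in> indep (relabel f M). I \<subseteq> f ` X} = (\<lambda>I. card (f ` I)) ` {I \<in> indep M. I \<subseteq> X}"
    by (simp add: image_image)
  then show ?thesis
    using assms by (simp add: rk_def card_image inj_on_subset)
qed

lemma sym_indicator_relabel:
  fixes M :: "'e::finite set_system"
  assumes f: "bij f"
  shows "sym_indicator (matroid_polytope (relabel f M)) = sym_indicator (matroid_polytope M)"
proof
  fix x :: "real ^ 'e"
  have inj: "inj f" using f by (rule bij_is_inj)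
  have "bases (relabel f M) =
      (`) f ` {B \<in> indep M. \<forall>I\<in>indep M. f ` B \<subseteq> f ` I \<longrightarrow> f ` I = f ` B}"
    by (auto simp: bases_def relabel_def)
  then have "bases (relabel f M) = (`) f ` bases M"
    by (simp add: bases_def inj_image_subset_iff[OF inj] inj_image_eq_iff[OF inj])
  moreover have "char_vec (f ` B) = (\<chi> i. char_vec B $ inv f i)" for B :: "'e set"
  proof -
    have "i \<in> f ` B \<longleftrightarrow> inv f i \<in> B" for i :: 'e
      using inj_image_mem_iff[OF inj, of "inv f i" B] surj_f_inv_f[OF bij_is_surj[OF f], of i]
      by simp
    then show ?thesis by (simp add: vec_eq_iff char_vec_def indicator_def)
  qed
  ultimately have "char_vec ` bases (relabel f M) = (\<lambda>y. \<chi> i. y $ inv f i) ` char_vec ` bases M"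
    by (simp add: image_image)
  then have "matroid_polytope (relabel f M) = (\<lambda>y. \<chi> i. y $ inv f i) ` matroid_polytope M"
    unfolding matroid_polytope_def by (simp add: convex_hull_linear_image linear_permute_coords)
  then have P: "matroid_polytope (relabel f M) = {x. (\<chi> i. x $ f i) \<in> matroid_polytope M}"
    using permuted_coords_vimage[OF f] by simp
  have "(\<Sum>\<sigma> | \<sigma> permutes UNIV. indicator (matroid_polytope (relabel f M)) (\<chi> i. x $ \<sigma> i)) =
      (\<Sum>\<sigma> | \<sigma> permutes UNIV. (indicator (matroid_polytope M) (\<chi> i. x $ (\<sigma> \<circ> f) i) :: real))"
    by (simp add: P indicator_def)
  also have "\<dots> = (\<Sum>\<sigma> | \<sigma> permutes UNIV. indicator (matroid_polytope M) (\<chi> i. x $ \<sigma> i))"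
    by (rule sum_permutations_compose_right[symmetric]) (use f in \<open>auto intro: bij_imp_permutes\<close>)
  finally show "sym_indicator (matroid_polytope (relabel f M)) x =
      sym_indicator (matroid_polytope M) x"
    by (simp add: sym_indicator_def)
qed

section \<open>Independence of the nested matroids\<close>

lemma image_flag:
  assumes "\<sigma> permutes UNIV" "\<tau> permutes UNIV"
  shows "(inv \<tau> \<circ> \<sigma>) ` flag \<sigma> t = flag \<tau> t"
proof
  show "(inv \<tau> \<circ> \<sigma>) ` flag \<sigma> t \<subseteq> flag \<tau> t"
    using assms by (auto simp: flag_def permutes_inverses)
  show "flag \<tau> t \<subseteq> (inv \<tau> \<circ> \<sigma>) ` flag \<sigma> t"
  proof
    fix e assume "e \<in> flag \<tau> t"
    then show "e \<in> (inv \<tau> \<circ> \<sigma>) ` flag \<sigma> t"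
      using assms by (intro image_eqI[of _ _ "inv \<sigma> (\<tau> e)"]) (auto simp: flag_def permutes_inverses)
  qed
qed

lemma bij_inv_comp:
  assumes "\<sigma> permutes UNIV" "\<tau> permutes UNIV"
  shows "bij (inv \<tau> \<circ> \<sigma>)"
  using assms by (metis bij_comp permutes_bij permutes_inv)

text \<open>Fix for \<open>N j\<close> a flag through its cyclic flats and count, for each \<open>N i\<close>, the flags along which the
ranks do not exceed those of \<open>N j\<close> along the fixed flag. A flag that is counted gives a bijection
that maps independent sets of \<open>N i\<close> to independent sets of \<open>N j\<close>, because independence in \<open>N j\<close> is
decided on cyclic flats. So the matrix of these counts is triangular with respect to the number of
independent sets, with nonzero diagonal.\<close>

lemma nested_sym_indicators_independent:
  fixes N :: "'k::finite \<Rightarrow> 'e::finite set_system"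
  assumes N: "enumerates_nested r N"
    and zero: "\<And>x. (\<Sum>i\<in>UNIV. c i * sym_indicator (matroid_polytope (N i)) x) = 0"
  shows "c i = 0"
proof (rule ccontr)
  assume "c i \<noteq> 0"
  then obtain j where cj: "c j \<noteq> 0"
    and jmin: "\<And>i. c i \<noteq> 0 \<Longrightarrow> card (indep (N j)) \<le> card (indep (N i))"
    using ex_has_least_nat[of "\<lambda>i. c i \<noteq> 0" i "\<lambda>i. card (indep (N i))"] by blast
  have NM: "matroid (N i)" "ground (N i) = UNIV" "N i \<in> matroids_of_rank r" "nested (N i)" for i
    using N by (auto simp: enumerates_nested_def matroids_of_rank_def)
  obtain \<tau> where \<tau>: "\<tau> permutes UNIV" "\<And>Z. Z \<in> cyclic_flats (N j) \<Longrightarrow> flag \<tau> (card Z) = Z"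
    using ex_flag_through_chain[of "cyclic_flats (N j)"] NM(4)[of j] by (auto simp: nested_def)
  define G :: "(nat \<Rightarrow> nat) \<Rightarrow> real"
    where "G q = of_bool (\<forall>t. q t \<le> rk (N j) (flag \<tau> t))" for q
  have lin: "(\<Sum>i\<in>UNIV. c i * flag_sum G (N i)) = 0"
    by (rule flag_sum_linear[where Ms = N]) (use NM zero in auto)
  have "c i * flag_sum G (N i) = 0" if ij: "i \<noteq> j" for i
  proof (rule ccontr)
    assume "c i * flag_sum G (N i) \<noteq> 0"
    then have ci: "c i \<noteq> 0" and "flag_sum G (N i) \<noteq> 0" by auto
    then obtain \<sigma> where \<sigma>: "\<sigma> permutes UNIV" "G (\<lambda>t. rk (N i) (flag \<sigma> t)) \<noteq> 0"
      unfolding flag_sum_def by (auto elim: sum.not_neutral_contains_not_neutral)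
    then have le: "rk (N i) (flag \<sigma> t) \<le> rk (N j) (flag \<tau> t)" for t
      by (auto simp: G_def split: if_splits)
    define f where "f = inv \<tau> \<circ> \<sigma>"
    have bij: "bij f" unfolding f_def by (rule bij_inv_comp[OF \<sigma>(1) \<tau>(1)])
    then have inj: "inj f" by (rule bij_is_inj)
    have im: "f ` X \<in> indep (N j)" if X: "X \<in> indep (N i)" for X
    proof -
      have "card (f ` X \<inter> Z) \<le> rk (N j) Z" if Z: "Z \<in> cyclic_flats (N j)" for Z
      proof -
        have "f ` X \<inter> Z = f ` (X \<inter> flag \<sigma> (card Z))"
          using image_flag[OF \<sigma>(1) \<tau>(1), of "card Z"] \<tau>(2)[OF Z] image_Int[OF inj]
          by (simp add: f_def)
        then have "card (f ` X \<inter> Z) = card (X \<inter> flag \<sigma> (card Z))"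
          using inj by (simp add: card_image inj_on_subset)
        also have "\<dots> \<le> rk (N i) (flag \<sigma> (card Z))"
          by (rule card_le_rk[OF NM(1) matroid_indep_subset[OF NM(1) X]]) auto
        also have "\<dots> \<le> rk (N j) Z" using le \<tau>(2)[OF Z] by metis
        finally show ?thesis .
      qed
      then show ?thesis using indep_iff_cyclic_flats[OF NM(1)[of j], of "f ` X"] NM(2) by simp
    qed
    have inj2: "inj_on ((`) f) (indep (N i))" using inj by (auto simp: inj_on_def inj_image_eq_iff)
    have sub: "(`) f ` indep (N i) \<subseteq> indep (N j)" using im by auto
    have "card ((`) f ` indep (N i)) = card (indep (N j))"
      using card_mono[OF _ sub] jmin[OF ci] by (simp add: card_image[OF inj2])
    then have eq: "(`) f ` indep (N i) = indep (N j)" using sub by (simp add: card_subset_eq)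
    have "matroid_iso (N i) (N j)"
      unfolding matroid_iso_def
    proof (intro exI conjI allI impI)
      show "bij_betw f (ground (N i)) (ground (N j))" using bij NM by simp
      show "X \<in> indep (N i) \<longleftrightarrow> f ` X \<in> indep (N j)" for X
        unfolding eq[symmetric] using inj by (auto simp: inj_image_eq_iff)
    qed
    moreover have "matroid_iso (N i) (N i)"
      unfolding matroid_iso_def by (intro exI[of _ id]) auto
    ultimately show False
      using N NM(3,4)[of i] ij unfolding enumerates_nested_def by blast
  qed
  then have "(\<Sum>i\<in>UNIV - {j}. c i * flag_sum G (N i)) = 0" by (intro sum.neutral) blast
  then have "(\<Sum>i\<in>UNIV. c i * flag_sum G (N i)) = c j * flag_sum G (N j)"
    by (subst sum.remove[of _ j]) simp_all
  moreover have "0 < flag_sum G (N j)"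
    unfolding flag_sum_def
    by (rule sum_pos2[of _ \<tau>]) (use \<tau>(1) in \<open>auto simp: G_def finite_permutations\<close>)
  ultimately show False using lin cj by simp
qed

section \<open>Uniqueness of tight flags\<close>

lemma rk_ge_if_all_rk_ge:
  fixes X :: "'e::finite set"
  assumes M: "matroid M" and ge: "\<And>Y. card Y = p \<Longrightarrow> \<rho> \<le> rk M Y" and p: "p \<le> CARD('e)"
  shows "\<rho> \<le> rk M X + (p - card X)"
proof (cases "p \<le> card X")
  case True
  then obtain Y where Y: "Y \<subseteq> X" "card Y = p" by (meson obtain_subset_with_card_n)
  then show ?thesis using ge[of Y] rk_mono[OF M Y(1)] by linarith
next
  case False
  then obtain Y where Y: "X \<subseteq> Y" "card Y = p"
    using exists_subset_between[of X p UNIV] p by auto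
  then show ?thesis
    using ge[of Y] rk_le_rk_plus_card_diff[OF M Y(1)] by (simp add: card_Diff_subset)
qed

text \<open>Suppose that \<open>F'\<close> arises from \<open>F\<close> by exchanging \<open>d\<close> elements. The lower bounds on ranks by size force
the rank of \<open>F \<union> F'\<close> to exceed \<open>\<rho>\<close> by at least \<open>min d a'\<close> and let the rank of \<open>F \<inter> F'\<close> fall below
\<open>\<rho>\<close> by at most \<open>d - b\<close> (or by nothing if \<open>d \<le> b\<close>). By submodularity \<open>min d a'\<close> is at most that loss,
and each of the two bounds on \<open>d\<close> makes the loss smaller than \<open>a'\<close>, which leaves only \<open>d = 0\<close>.\<close>

lemma tight_sets_eq:
  fixes F F' :: "'e::finite set"
  assumes M: "matroid M" and card: "card F = s" "card F' = s" and tight: "rk M F \<le> \<rho>" "rk M F' \<le> \<rho>"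
    and low: "\<And>Y. card Y = s - b \<Longrightarrow> \<rho> \<le> rk M Y"
    and high: "\<And>Y. card Y = s + a' \<Longrightarrow> \<rho> + a' \<le> rk M Y" and s: "s + a' \<le> CARD('e)"
    and pos: "0 < b" "0 < a'"
    and d: "card (F' - F) \<le> a + b \<and> a < a' \<or> card (F' - F) \<le> a' + b' \<and> b' < b"
  shows "F = F'"
proof -
  define d where "d = card (F' - F)"
  have un: "card (F \<union> F') = s + d"
    using card_Un_disjoint[of F "F' - F"] card by (simp add: d_def)
  have int: "card (F \<inter> F') + d = s"
    using card_Int_Diff[of F' F] card by (simp add: d_def Int_commute)
  have "\<rho> + a' \<le> rk M (F \<union> F') + (s + a' - card (F \<union> F'))"
    by (rule rk_ge_if_all_rk_ge[OF M high s])
  moreover have "\<rho> \<le> rk M (F \<inter> F') + (s - b - card (F \<inter> F'))"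
    by (rule rk_ge_if_all_rk_ge[OF M low]) (use s in auto)
  moreover have "rk M (F \<union> F') + rk M (F \<inter> F') \<le> rk M F + rk M F'"
    by (rule rk_submodular[OF M])
  \<comment> \<open>Truncated subtraction on the natural numbers expresses the minimum and the loss.\<close>
  ultimately have "a' \<le> (a' - d) + (d - b)" using un int tight by linarith
  then have "d = 0" using d pos unfolding d_def[symmetric] by linarith
  then show ?thesis using card by (metis card_0_eq card_subset_eq d_def finite Diff_eq_empty_iff)
qed

text \<open>Up to position \<open>k\<close> two flags are compared from the bottom: if they agree at \<open>i - 1\<close>, then their
members at \<open>i\<close> differ by an exchange of at most \<open>a i + b i\<close> elements, and \<open>a i < a (i + 1)\<close> makes them
equal. After \<open>k\<close> they are compared from the top: if they agree at \<open>i + 1\<close>, then at most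
\<open>a (i + 1) + b (i + 1)\<close> elements are exchanged at \<open>i\<close>, and \<open>b (i + 1) < b i\<close> applies.\<close>

lemma tight_flags_unique:
  fixes M :: "'e::finite set_system" and a b :: "nat \<Rightarrow> nat" and F F' :: "nat \<Rightarrow> 'e set"
  defines "s \<equiv> \<lambda>i. \<Sum>j=1..i. a j + b j" and "A \<equiv> \<lambda>i. \<Sum>j=1..i. a j"
  assumes M: "matroid M" and pos: "\<And>i. i \<in> {1..n} \<Longrightarrow> 0 < a i \<and> 0 < b i"
    and top: "s n = CARD('e)" and k: "k < n"
    and up: "\<And>i. i \<in> {1..k} \<Longrightarrow> a i < a (i + 1)"
    and down: "\<And>i. i \<in> {k+1..n-1} \<Longrightarrow> b (i + 1) < b i"
    and spread: "\<And>i Y. i \<in> {1..n} \<Longrightarrow> card Y = s i - b i \<Longrightarrow> A i \<le> rk M Y"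
    and F: "\<And>i j. i \<le> j \<Longrightarrow> F i \<subseteq> F j" "\<And>i. i \<le> n \<Longrightarrow> card (F i) = s i"
      "\<And>i. i \<le> n \<Longrightarrow> rk M (F i) \<le> A i"
    and F': "\<And>i j. i \<le> j \<Longrightarrow> F' i \<subseteq> F' j" "\<And>i. i \<le> n \<Longrightarrow> card (F' i) = s i"
      "\<And>i. i \<le> n \<Longrightarrow> rk M (F' i) \<le> A i"
    and i: "i \<le> n"
  shows "F i = F' i"
proof -
  have sS: "s (Suc i) = s i + (a (Suc i) + b (Suc i))" and AS: "A (Suc i) = A i + a (Suc i)" for i
    by (simp_all add: s_def A_def)
  have s_mono: "s i \<le> s j" if "i \<le> j" for i j
    unfolding s_def using that by (intro sum_mono2) auto
  have eqI: "F i = F' i" if i: "1 \<le> i" "i < n"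
    and d: "card (F' i - F i) \<le> a i + b i \<and> a i < a (Suc i) \<or>
      card (F' i - F i) \<le> a (Suc i) + b (Suc i) \<and> b (Suc i) < b i" for i
  proof (rule tight_sets_eq[OF M, of _ "s i" _ "A i" "b i" "a (Suc i)" "a i" "b (Suc i)"])
    show "A i + a (Suc i) \<le> rk M Y" if "card Y = s i + a (Suc i)" for Y
      using spread[of "Suc i" Y] that i sS AS by simp
    show "s i + a (Suc i) \<le> CARD('e)" using sS[of i] s_mono[of "Suc i" n] top i by simp
    show "A i \<le> rk M Y" if "card Y = s i - b i" for Y using spread[of i Y] that i by simp
  qed (use i d F F' pos in auto)
  have low: "i \<le> k \<Longrightarrow> F i = F' i" for i
  proof (induction i)
    case 0
    have "card (F 0) = 0" "card (F' 0) = 0" using F(2)[of 0] F'(2)[of 0] by (simp_all add: s_def)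
    then show ?case by simp
  next
    case (Suc i)
    then have eq: "F i = F' i" by simp
    have "card (F' (Suc i) - F (Suc i)) \<le> card (F' (Suc i) - F' i)"
      using F(1)[of i "Suc i"] eq by (intro card_mono) auto
    also have "\<dots> = a (Suc i) + b (Suc i)"
      using F'(1)[of i "Suc i"] F'(2)[of i] F'(2)[of "Suc i"] sS[of i] Suc.prems k
      by (simp add: card_Diff_subset)
    finally show ?case using up[of "Suc i"] Suc.prems k by (intro eqI) auto
  qed
  have high: "F i = F' i" if "k < i" "i \<le> n" for i
    using that(2,1)
  proof (induction i rule: inc_induct)
    case base
    have "F n = UNIV" "F' n = UNIV" using F(2)[of n] F'(2)[of n] top by (simp_all add: card_eq_UNIV_imp_eq_UNIV)
    then show ?case by simp
  next
    case (step i)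
    then have eq: "F (Suc i) = F' (Suc i)" by simp
    have "card (F' i - F i) \<le> card (F (Suc i) - F i)"
      using F'(1)[of i "Suc i"] eq by (intro card_mono) auto
    also have "\<dots> = a (Suc i) + b (Suc i)"
      using F(1)[of i "Suc i"] F(2)[of i] F(2)[of "Suc i"] sS[of i] step
      by (simp add: card_Diff_subset)
    finally show ?case using down[of i] step by (intro eqI) auto
  qed
  show ?thesis using low high i by (cases "i \<le> k") auto
qed

section \<open>Extreme points from linear functionals\<close>

text \<open>The point together with the open halfspace below it is convex, hence contains the whole hull; so
both ends of a segment through the point would have smaller values than the point itself.\<close>

lemma extreme_point_of_convex_hull_if_unique_max:
  fixes v :: "'v::real_vector"
  assumes f: "linear f" and v: "v \<in> W" and max: "\<And>w. w \<in> W \<Longrightarrow> w \<noteq> v \<Longrightarrow> f w < (f v :: real)"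
  shows "v extreme_point_of (convex hull W)"
proof -
  interpret linear f by (rule f)
  have "convex (insert v {x. f x < f v})"
  proof (rule convexI)
    fix x y :: 'v and t u :: real
    assume xy: "x \<in> insert v {x. f x < f v}" "y \<in> insert v {x. f x < f v}"
      and tu: "0 \<le> t" "0 \<le> u" "t + u = 1"
    show "t *\<^sub>R x + u *\<^sub>R y \<in> insert v {x. f x < f v}"
    proof (cases "t = 0 \<or> u = 0 \<or> x = v \<and> y = v")
      case True
      then show ?thesis using xy tu by (auto simp flip: scaleR_add_left)
    next
      case False
      have "t * f x \<le> t * f v" "u * f y \<le> u * f v"
        using xy tu by (auto intro!: mult_left_mono)
      moreover have "t * f x < t * f v \<or> u * f y < u * f v"
        using xy tu False by auto
      moreover have "t * f v + u * f v = f v" using tu by (simp flip: distrib_right)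
      ultimately have "t * f x + u * f y < f v" by linarith
      then show ?thesis by (simp add: add scale)
    qed
  qed
  then have hull: "convex hull W \<subseteq> insert v {x. f x < f v}"
    using max by (intro hull_minimal) auto
  show ?thesis
    unfolding extreme_point_of_def
  proof (intro conjI ballI notI)
    show "v \<in> convex hull W" using v by (rule hull_inc)
  next
    fix x y assume xy: "x \<in> convex hull W" "y \<in> convex hull W" and seg: "v \<in> open_segment x y"
    have "x \<noteq> v" "y \<noteq> v" using seg by (auto simp: open_segment_def)
    then have lt: "f x < f v" "f y < f v" using xy hull by auto
    obtain t where t: "v = (1 - t) *\<^sub>R x + t *\<^sub>R y" "0 < t" "t < 1"
      using seg by (auto simp: in_segment)
    have "f v = (1 - t) * f x + t * f y" by (subst t(1)) (simp add: add scale)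
    also have "\<dots> < (1 - t) * f v + t * f v"
      using lt t by (intro add_strict_mono mult_strict_left_mono) auto
    finally show False by (simp add: algebra_simps)
  qed
qed

lemma flag_sum_eq_if_sym_indicator_eq:
  fixes M M' :: "'e::finite set_system"
  assumes "matroid M" "ground M = UNIV" "matroid M'" "ground M' = UNIV"
    and "sym_indicator (matroid_polytope M) = sym_indicator (matroid_polytope M')"
  shows "flag_sum G M = flag_sum G M'"
  using flag_sum_linear[of "UNIV :: bool set" "\<lambda>x. if x then M else M'" "\<lambda>x. if x then 1 else -1" G]
    assms by (simp add: UNIV_bool)

lemma flag_sum_eq_of_coord_vec:
  fixes N :: "'k::finite \<Rightarrow> 'e::finite set_system"
  assumes N: "enumerates_nested r N" and M: "matroid M" "ground M = UNIV" and w: "is_coord_vec N M w"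
  shows "flag_sum G M = (\<Sum>i\<in>UNIV. w $ i * flag_sum G (N i))"
proof -
  \<comment> \<open>The relation that defines \<open>w\<close> becomes a vanishing combination, with \<open>M\<close> at index \<open>None\<close>.\<close>
  define Ms where "Ms = case_option M N"
  define c where "c = case_option (-1) (\<lambda>i. w $ i)"
  have sum_option: "(\<Sum>x\<in>UNIV. g x) = g None + (\<Sum>i\<in>UNIV. g (Some i))" for g :: "'k option \<Rightarrow> real"
    by (simp add: UNIV_option_conv sum.reindex)
  have NM: "matroid (N i)" "ground (N i) = UNIV" for i
    using N by (auto simp: enumerates_nested_def matroids_of_rank_def)
  have "(\<Sum>x\<in>UNIV. c x * flag_sum G (Ms x)) = 0"
  proof (rule flag_sum_linear)
    show "(\<Sum>x\<in>UNIV. c x * sym_indicator (matroid_polytope (Ms x)) y) = 0" for y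
      using w by (simp add: sum_option c_def Ms_def is_coord_vec_def)
  qed (use M NM in \<open>auto simp: Ms_def split: option.splits\<close>)
  then show ?thesis by (simp add: sum_option c_def Ms_def)
qed

lemma flag_sum_of_bool:
  "flag_sum (\<lambda>q. of_bool (P q)) M = card {\<sigma>. \<sigma> permutes UNIV \<and> P (\<lambda>t. rk M (flag \<sigma> t))}"
proof -
  have "flag_sum (\<lambda>q. of_bool (P q)) M = (\<Sum>\<sigma> | \<sigma> permutes UNIV \<and> P (\<lambda>t. rk M (flag \<sigma> t)). 1)"
    unfolding flag_sum_def by (rule sum.mono_neutral_cong_right) (auto simp: finite_permutations)
  then show ?thesis by simp
qed

section \<open>A functional maximised by the free product\<close>

text \<open>The three sufficient conditions have a common form: there is a pivot position \<open>k + 1\<close> such that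
\<open>a\<close> increases strictly up to it and \<open>b\<close> decreases strictly from it. The extreme cases \<open>k = n - 1\<close>
and \<open>k = 0\<close> are the purely increasing and the purely decreasing condition.\<close>

locale pivoted_blocks =
  fixes n k :: nat and a b :: "nat \<Rightarrow> nat" and S :: "nat \<Rightarrow> 'e::finite set"
  assumes k: "k < n"
    and pos: "i \<in> {1..n} \<Longrightarrow> 0 < a i \<and> 0 < b i"
    and card_S: "i \<in> {1..n} \<Longrightarrow> card (S i) = a i + b i"
    and disj: "disjoint_family_on S {1..n}"
    and cover: "(\<Union>i\<in>{1..n}. S i) = UNIV"
    and up: "i \<in> {1..k} \<Longrightarrow> a i < a (i + 1)"
    and down: "i \<in> {k+1..n-1} \<Longrightarrow> b (i + 1) < b i"
begin

definition size_upto :: "nat \<Rightarrow> nat" where "size_upto i = (\<Sum>j=1..i. a j + b j)"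
definition rank_upto :: "nat \<Rightarrow> nat" where "rank_upto i = (\<Sum>j=1..i. a j)"
definition F :: "nat \<Rightarrow> 'e set" where "F i = (\<Union>j\<in>{1..i}. S j)"
definition M :: "'e set_system" where "M = capped UNIV {1..n} F rank_upto"

lemma size_upto_Suc: "size_upto (Suc i) = size_upto i + (a (Suc i) + b (Suc i))"
  and rank_upto_Suc: "rank_upto (Suc i) = rank_upto i + a (Suc i)"
  by (simp_all add: size_upto_def rank_upto_def)

lemma F_mono: "i \<le> j \<Longrightarrow> F i \<subseteq> F j"
  unfolding F_def by (intro UN_mono) auto

lemma card_F: "i \<le> n \<Longrightarrow> card (F i) = size_upto i"
proof -
  assume i: "i \<le> n"
  have "card (F i) = (\<Sum>j\<in>{1..i}. card (S j))"
    unfolding F_def using disj i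
    by (intro card_UN_disjoint) (auto simp: disjoint_family_on_def)
  also have "\<dots> = size_upto i"
    unfolding size_upto_def using card_S i by (intro sum.cong) auto
  finally show ?thesis .
qed

lemma F_n: "F n = UNIV" unfolding F_def by (rule cover)

lemma size_upto_n: "size_upto n = CARD('e)" using card_F[of n] F_n by simp

lemma F_chain: "F i \<subseteq> F j \<or> F j \<subseteq> F i"
  using F_mono nat_le_linear by blast

lemma matroid_M: "matroid M" and ground_M: "ground M = UNIV"
  unfolding M_def by (rule matroid_capped) (use F_chain in simp_all)

lemma nested_M: "nested M"
  unfolding M_def by (rule nested_capped) (use F_chain in auto)

lemma rk_M_le: "i \<in> {1..n} \<Longrightarrow> rk M X \<le> rank_upto i + card (X - F i)"
  unfolding M_def by (rule rk_capped_le) (use F_chain in auto)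

lemma rk_M_F: "i \<in> {1..n} \<Longrightarrow> rk M (F i) \<le> rank_upto i"
  using rk_M_le[of i "F i"] by simp

lemma rank_upto_diff_le: "i \<le> j \<Longrightarrow> rank_upto j + size_upto i \<le> rank_upto i + size_upto j"
  by (induction j rule: dec_induct) (auto simp: size_upto_Suc rank_upto_Suc)

lemma rank_upto_mono: "i \<le> j \<Longrightarrow> rank_upto i \<le> rank_upto j"
  unfolding rank_upto_def by (intro sum_mono2) auto

lemma rank_upto_le_size_upto: "rank_upto i \<le> size_upto i"
  unfolding rank_upto_def size_upto_def by (intro sum_mono) auto

text \<open>The number \<open>size_upto i - b i\<close> equals \<open>size_upto (i - 1) + a i\<close>. A set \<open>Y\<close> of this size has at least
\<open>size_upto (i - 1) + a i - size_upto j\<close> elements outside \<open>F j\<close> for \<open>j < i\<close>, which makes up for the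
missing capacities of the blocks \<open>j + 1\<close> to \<open>i\<close>.\<close>

lemma spread_M:
  assumes i: "i \<in> {1..n}" and Y: "card Y = size_upto i - b i"
  shows "rank_upto i \<le> rk M Y"
  unfolding M_def
proof (rule le_rk_capped)
  obtain h where h: "i = Suc h" using i by (cases i) auto
  have cY: "card Y = size_upto h + a i" using Y by (simp add: h size_upto_Suc)
  show "rank_upto i \<le> card Y" using cY rank_upto_le_size_upto[of h] by (simp add: h rank_upto_Suc)
  fix j assume j: "j \<in> {1..n}"
  show "rank_upto i \<le> rank_upto j + card (Y - F j)"
  proof (cases "i \<le> j")
    case False
    have "card Y - card (F j) \<le> card (Y - F j)" by (rule diff_card_le_card_Diff) simp
    then have "size_upto h + a i - size_upto j \<le> card (Y - F j)" using cY card_F[of j] j by simp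
    moreover have "rank_upto h + size_upto j \<le> rank_upto j + size_upto h" using False h by (intro rank_upto_diff_le) auto
    ultimately show ?thesis by (simp add: h rank_upto_Suc)
  qed (use rank_upto_mono[of i j] in simp)
qed (use F_chain in auto)

lemma rk_M_UNIV: "rk M UNIV = rank_upto n"
proof (rule antisym)
  show "rk M UNIV \<le> rank_upto n" using rk_M_F[of n] k by (simp add: F_n)
  obtain Y :: "'e set" where "card Y = size_upto n - b n"
    using obtain_subset_with_card_n[of "size_upto n - b n" "UNIV :: 'e set"] size_upto_n by auto
  then have "rank_upto n \<le> rk M Y" using k by (intro spread_M) auto
  also have "\<dots> \<le> rk M UNIV" by (rule rk_mono[OF matroid_M]) simp
  finally show "rank_upto n \<le> rk M UNIV" .
qed

lemma M_in_matroids_of_rank: "M \<in> matroids_of_rank (rank_upto n)"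
  by (simp add: matroids_of_rank_def matroid_M ground_M rk_M_UNIV)

definition perms :: real where "perms = card {\<sigma>::'e \<Rightarrow> 'e. \<sigma> permutes UNIV}"

text \<open>The weight encodes a lexicographic order. First, no set of size \<open>size_upto i - b i\<close> may have rank
below \<open>rank_upto i\<close>; second, there should be a flag on which the ranks \<open>rank_upto i\<close> are not exceeded
at the sizes \<open>size_upto i\<close>; third, there should be as many bases as possible. Each of the three
counts is at most \<open>perms\<close>, so powers of \<open>perms + 1\<close> separate the levels.\<close>

definition weight :: "(nat \<Rightarrow> nat) \<Rightarrow> real" where
  "weight q = of_bool (rank_upto n \<le> q (rank_upto n)) + (perms + 1) * of_bool (\<forall>i\<in>{1..n}. q (size_upto i) \<le> rank_upto i)
     - (perms + 1)\<^sup>2 * of_bool (\<exists>i\<in>{1..n}. q (size_upto i - b i) < rank_upto i)"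

definition base_flags :: "'e set_system \<Rightarrow> ('e \<Rightarrow> 'e) set" where
  "base_flags N = {\<sigma>. \<sigma> permutes UNIV \<and> rank_upto n \<le> rk N (flag \<sigma> (rank_upto n))}"

definition tight_flags :: "'e set_system \<Rightarrow> ('e \<Rightarrow> 'e) set" where
  "tight_flags N = {\<sigma>. \<sigma> permutes UNIV \<and> (\<forall>i\<in>{1..n}. rk N (flag \<sigma> (size_upto i)) \<le> rank_upto i)}"

definition deficient_flags :: "'e set_system \<Rightarrow> ('e \<Rightarrow> 'e) set" where
  "deficient_flags N = {\<sigma>. \<sigma> permutes UNIV \<and> (\<exists>i\<in>{1..n}. rk N (flag \<sigma> (size_upto i - b i)) < rank_upto i)}"

lemma flag_sum_weight:
  "flag_sum weight N = card (base_flags N) + (perms + 1) * card (tight_flags N)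
     - (perms + 1)\<^sup>2 * card (deficient_flags N)"
proof -
  have "flag_sum weight N = flag_sum (\<lambda>q. of_bool (rank_upto n \<le> q (rank_upto n))) N
      + (perms + 1) * flag_sum (\<lambda>q. of_bool (\<forall>i\<in>{1..n}. q (size_upto i) \<le> rank_upto i)) N
      - (perms + 1)\<^sup>2 * flag_sum (\<lambda>q. of_bool (\<exists>i\<in>{1..n}. q (size_upto i - b i) < rank_upto i)) N"
    unfolding flag_sum_def weight_def sum.distrib sum_subtractf sum_distrib_left ..
  then show ?thesis
    by (simp only: flag_sum_of_bool base_flags_def tight_flags_def deficient_flags_def)
qed

lemma finite_flags: "finite (base_flags N)" "finite (tight_flags N)" "finite (deficient_flags N)"
  and card_base_flags_le: "card (base_flags N) \<le> perms"
  and card_tight_flags_le: "card (tight_flags N) \<le> perms"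
proof -
  have fin: "finite {\<sigma>::'e \<Rightarrow> 'e. \<sigma> permutes UNIV}" by (simp add: finite_permutations)
  have sub: "base_flags N \<subseteq> {\<sigma>. \<sigma> permutes UNIV}" "tight_flags N \<subseteq> {\<sigma>. \<sigma> permutes UNIV}"
    "deficient_flags N \<subseteq> {\<sigma>. \<sigma> permutes UNIV}"
    by (auto simp: base_flags_def tight_flags_def deficient_flags_def)
  show "finite (base_flags N)" "finite (tight_flags N)" "finite (deficient_flags N)"
    using sub fin by (meson finite_subset)+
  show "card (base_flags N) \<le> perms" "card (tight_flags N) \<le> perms"
    unfolding perms_def of_nat_le_iff by (intro card_mono fin sub)+
qed

lemma deficient_flags_empty_iff:
  "deficient_flags N = {} \<longleftrightarrow> (\<forall>i\<in>{1..n}. \<forall>Y. card Y = size_upto i - b i \<longrightarrow> rank_upto i \<le> rk N Y)"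
proof
  assume empty: "deficient_flags N = {}"
  show "\<forall>i\<in>{1..n}. \<forall>Y. card Y = size_upto i - b i \<longrightarrow> rank_upto i \<le> rk N Y"
  proof (intro ballI allI impI)
    fix i and Y :: "'e set" assume i: "i \<in> {1..n}" and Y: "card Y = size_upto i - b i"
    obtain \<rho> where \<rho>: "\<rho> permutes UNIV" "flag \<rho> (card Y) = Y"
      using ex_flag_through_chain[of "{Y}"] by auto
    then show "rank_upto i \<le> rk N Y" using empty i Y by (auto simp: deficient_flags_def not_less)
  qed
next
  assume spread: "\<forall>i\<in>{1..n}. \<forall>Y. card Y = size_upto i - b i \<longrightarrow> rank_upto i \<le> rk N Y"
  have "\<not> rk N (flag \<sigma> (size_upto i - b i)) < rank_upto i" if \<sigma>: "\<sigma> permutes UNIV" "i \<in> {1..n}" for \<sigma> i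
  proof -
    have "size_upto i \<le> size_upto n" unfolding size_upto_def using \<sigma> by (intro sum_mono2) auto
    then have "card (flag \<sigma> (size_upto i - b i)) = size_upto i - b i" using \<sigma> size_upto_n by (intro card_flag) auto
    then show ?thesis using spread \<sigma>(2) by (auto simp: not_less)
  qed
  then show "deficient_flags N = {}" by (auto simp: deficient_flags_def)
qed

lemma deficient_flags_M: "deficient_flags M = {}"
  unfolding deficient_flags_empty_iff using spread_M by blast

lemma ex_flag_F:
  obtains \<sigma> where "\<sigma> permutes UNIV" "\<And>i. i \<le> n \<Longrightarrow> flag \<sigma> (size_upto i) = F i"
proof -
  obtain \<sigma> where \<sigma>: "\<sigma> permutes UNIV" "\<And>X. X \<in> F ` {..n} \<Longrightarrow> flag \<sigma> (card X) = X"
    using ex_flag_through_chain[of "F ` {..n}"] F_chain by blast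
  have "flag \<sigma> (size_upto i) = F i" if "i \<le> n" for i
    using \<sigma>(2)[of "F i"] card_F[OF that] that by auto
  then show thesis using that \<sigma>(1) by blast
qed

lemma le_flag_sum_weight_M: "perms + 1 \<le> flag_sum weight M"
proof -
  obtain \<sigma> where \<sigma>: "\<sigma> permutes UNIV" "\<And>i. i \<le> n \<Longrightarrow> flag \<sigma> (size_upto i) = F i"
    by (rule ex_flag_F) blast
  have "\<sigma> \<in> tight_flags M" using \<sigma> rk_M_F by (simp add: tight_flags_def)
  then have "1 \<le> card (tight_flags M)" using finite_flags by (auto simp: Suc_le_eq card_gt_0_iff)
  then have "(perms + 1) * 1 \<le> (perms + 1) * card (tight_flags M)"
    by (intro mult_left_mono) (auto simp: perms_def)
  then show ?thesis unfolding flag_sum_weight by (simp add: deficient_flags_M)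
qed

lemma flag_eq_F_if_tight:
  assumes N: "matroid N" and spread: "\<And>i Y. i \<in> {1..n} \<Longrightarrow> card Y = size_upto i - b i \<Longrightarrow> rank_upto i \<le> rk N Y"
    and F: "\<And>i. i \<in> {1..n} \<Longrightarrow> rk N (F i) \<le> rank_upto i"
    and \<sigma>: "\<sigma> permutes UNIV" "\<And>i. i \<in> {1..n} \<Longrightarrow> rk N (flag \<sigma> (size_upto i)) \<le> rank_upto i"
    and i: "i \<le> n"
  shows "flag \<sigma> (size_upto i) = F i"
proof (rule tight_flags_unique[where a = a and b = b and n = n and k = k, OF N])
  have szle: "size_upto i \<le> size_upto j" if "i \<le> j" for i j
    unfolding size_upto_def using that by (intro sum_mono2) auto
  show "flag \<sigma> (size_upto i) \<subseteq> flag \<sigma> (size_upto j)" if "i \<le> j" for i j using szle[OF that] by (rule flag_mono)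
  show "card (flag \<sigma> (size_upto i)) = (\<Sum>j=1..i. a j + b j)" if "i \<le> n" for i
    unfolding size_upto_def[symmetric] using \<sigma>(1) szle[OF that] size_upto_n by (intro card_flag) auto
  have zero: "rk N {} = 0" using rk_le_card[OF N, of "{}"] by simp
  show "rk N (flag \<sigma> (size_upto i)) \<le> (\<Sum>j=1..i. a j)" if "i \<le> n" for i
    unfolding rank_upto_def[symmetric]
    using \<sigma>(2)[of i] that zero by (cases "i = 0") (auto simp: size_upto_def flag_def)
  show "rk N (F i) \<le> (\<Sum>j=1..i. a j)" if "i \<le> n" for i
    unfolding rank_upto_def[symmetric] using F[of i] that zero by (cases "i = 0") (auto simp: F_def)
qed (use pos size_upto_n k up down spread F_mono card_F i in \<open>auto simp: size_upto_def rank_upto_def\<close>)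

text \<open>The capacities of \<open>M\<close> hold in \<open>N\<close>, so \<open>N\<close> has no other independent sets than \<open>M\<close>. The first two levels
of the weight agree for both matroids, because tight flags pass through the sets \<open>F i\<close> and are
determined by this. What remains is a comparison of the numbers of bases.\<close>

lemma flag_sum_weight_le_if_tight:
  assumes N: "N \<in> matroids_of_rank (rank_upto n)"
    and spread: "\<And>i Y. i \<in> {1..n} \<Longrightarrow> card Y = size_upto i - b i \<Longrightarrow> rank_upto i \<le> rk N Y"
    and F: "\<And>i. i \<in> {1..n} \<Longrightarrow> rk N (F i) \<le> rank_upto i"
  shows "flag_sum weight N \<le> flag_sum weight M"
    and "flag_sum weight N = flag_sum weight M \<Longrightarrow> N = M"
proof -
  have NM: "matroid N" "ground N = UNIV" "rk N UNIV = rank_upto n"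
    using N by (auto simp: matroids_of_rank_def)
  have indep: "indep N \<subseteq> indep M"
  proof
    fix X assume X: "X \<in> indep N"
    have "card (X \<inter> F i) \<le> rank_upto i" if "i \<in> {1..n}" for i
      using card_le_rk[OF NM(1) matroid_indep_subset[OF NM(1) X Int_lower1] Int_lower2, of "F i"] F[OF that]
      by linarith
    then show "X \<in> indep M" by (simp add: M_def indep_capped)
  qed
  have rk_le: "rk N X \<le> rk M X" for X
    by (metis NM(1) card_le_rk indep matroid_M rk_attained subsetD)
  have tight: "tight_flags L = {\<sigma>. \<sigma> permutes UNIV \<and> (\<forall>i\<in>{1..n}. flag \<sigma> (size_upto i) = F i)}"
    if "matroid L" "\<And>i Y. i \<in> {1..n} \<Longrightarrow> card Y = size_upto i - b i \<Longrightarrow> rank_upto i \<le> rk L Y"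
      "\<And>i. i \<in> {1..n} \<Longrightarrow> rk L (F i) \<le> rank_upto i" for L
    using flag_eq_F_if_tight[OF that] that(3) by (fastforce simp: tight_flags_def)
  have "tight_flags N = tight_flags M"
    using tight[OF NM(1) spread F] tight[OF matroid_M spread_M rk_M_F] by simp
  moreover have "deficient_flags N = {}" unfolding deficient_flags_empty_iff using spread by blast
  ultimately have diff:
    "flag_sum weight M - flag_sum weight N = real (card (base_flags M)) - card (base_flags N)"
    unfolding flag_sum_weight deficient_flags_M by simp
  have sub: "base_flags N \<subseteq> base_flags M"
    using rk_le by (auto simp: base_flags_def intro: order_trans)
  then have "card (base_flags N) \<le> card (base_flags M)" by (rule card_mono[OF finite_flags(1)])
  then show "flag_sum weight N \<le> flag_sum weight M" using diff by linarith
  assume "flag_sum weight N = flag_sum weight M"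
  then have bas: "base_flags N = base_flags M"
    using diff sub by (intro card_subset_eq[OF finite_flags(1)]) auto
  have "indep M \<subseteq> indep N"
  proof
    fix X assume "X \<in> indep M"
    then obtain B where B: "B \<in> indep M" "X \<subseteq> B" "card B = rank_upto n"
      using indep_extends_to_rk[OF matroid_M, of X UNIV] rk_M_UNIV by auto
    obtain \<sigma> where \<sigma>: "\<sigma> permutes UNIV" "flag \<sigma> (card B) = B"
      using ex_flag_through_chain[of "{B}"] by auto
    have "rk M B = card B" using B rk_eq_card_iff_indep[OF matroid_M, of B] by simp
    then have "\<sigma> \<in> base_flags M" using \<sigma> B by (simp add: base_flags_def)
    then have "\<sigma> \<in> base_flags N" unfolding bas .
    then have "rank_upto n \<le> rk N B" using \<sigma> B by (simp add: base_flags_def)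
    then have "B \<in> indep N"
      using rk_eq_card_iff_indep[OF NM(1), of B] rk_le_card[OF NM(1), of B] B by simp
    then show "X \<in> indep N" using matroid_indep_subset[OF NM(1)] B by blast
  qed
  then show "N = M" using indep NM ground_M by (simp add: set_system.expand)
qed

text \<open>A matroid that fails on one of the first two levels stays strictly below \<open>M\<close>. Otherwise it has a
tight flag, and a relabelling, which changes neither the symmetrized indicator function nor the
weight, moves this flag to the chain \<open>F\<close>.\<close>

lemma flag_sum_weight_le:
  assumes N: "N \<in> matroids_of_rank (rank_upto n)"
  shows "flag_sum weight N \<le> flag_sum weight M"
    and "flag_sum weight N = flag_sum weight M \<Longrightarrow>
      sym_indicator (matroid_polytope N) = sym_indicator (matroid_polytope M)"
proof -
  have NM: "matroid N" "ground N = UNIV" "rk N UNIV = rank_upto n"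
    using N by (auto simp: matroids_of_rank_def)
  have perms: "0 \<le> perms" by (simp add: perms_def)
  consider (deficient) "deficient_flags N \<noteq> {}"
    | (no_flag) "deficient_flags N = {}" "tight_flags N = {}"
    | (tight) "deficient_flags N = {}" "tight_flags N \<noteq> {}"
    by blast
  then have "flag_sum weight N < flag_sum weight M \<or>
    flag_sum weight N \<le> flag_sum weight M \<and> (flag_sum weight N = flag_sum weight M \<longrightarrow>
      sym_indicator (matroid_polytope N) = sym_indicator (matroid_polytope M))"
  proof cases
    case deficient
    then have "1 \<le> card (deficient_flags N)"
      using finite_flags by (simp add: Suc_le_eq card_gt_0_iff)
    then have "(perms + 1)\<^sup>2 * 1 \<le> (perms + 1)\<^sup>2 * card (deficient_flags N)"
      by (intro mult_left_mono) auto
    moreover have "(perms + 1) * card (tight_flags N) \<le> (perms + 1) * perms"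
      using card_tight_flags_le perms by (intro mult_left_mono) auto
    moreover have "perms + (perms + 1) * perms - (perms + 1)\<^sup>2 * 1 = -1"
      by (simp add: power2_eq_square algebra_simps)
    ultimately have "flag_sum weight N < 0"
      unfolding flag_sum_weight using card_base_flags_le[of N] by linarith
    then show ?thesis using le_flag_sum_weight_M perms by linarith
  next
    case no_flag
    have "flag_sum weight N = card (base_flags N)" unfolding flag_sum_weight no_flag by simp
    then show ?thesis using le_flag_sum_weight_M card_base_flags_le[of N] by linarith
  next
    case tight
    then obtain \<sigma> where \<sigma>: "\<sigma> permutes UNIV"
        "\<And>i. i \<in> {1..n} \<Longrightarrow> rk N (flag \<sigma> (size_upto i)) \<le> rank_upto i"
      by (auto simp: tight_flags_def)
    obtain \<tau> where \<tau>: "\<tau> permutes UNIV" "\<And>i. i \<le> n \<Longrightarrow> flag \<tau> (size_upto i) = F i"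
      by (rule ex_flag_F) blast
    define f where "f = inv \<tau> \<circ> \<sigma>"
    have bij: "bij f" unfolding f_def by (rule bij_inv_comp[OF \<sigma>(1) \<tau>(1)])
    then have inj: "inj f" by (rule bij_is_inj)
    let ?N = "relabel f N"
    have ground: "ground ?N = UNIV" using bij NM by (simp add: relabel_def bij_is_surj)
    have "rk ?N (f ` UNIV) = rank_upto n" unfolding rk_relabel[OF inj] by (rule NM)
    then have mem: "?N \<in> matroids_of_rank (rank_upto n)"
      using matroid_relabel[OF inj NM(1)] ground bij
      by (simp add: matroids_of_rank_def bij_is_surj)
    have spread: "rank_upto i \<le> rk ?N Y" if i: "i \<in> {1..n}" and Y: "card Y = size_upto i - b i" for i Y
    proof -
      define X where "X = inv f ` Y"
      have fX: "f ` X = Y" unfolding X_def using bij by (simp add: image_f_inv_f bij_is_surj)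
      have "card X = card Y" unfolding fX[symmetric] using inj by (simp add: card_image inj_on_subset)
      then have cX: "card X = size_upto i - b i" using Y by simp
      have "rank_upto i \<le> rk N X" using tight(1) i cX by (simp add: deficient_flags_empty_iff)
      then show ?thesis using rk_relabel[OF inj, of N X] fX by simp
    qed
    have tightF: "rk ?N (F i) \<le> rank_upto i" if i: "i \<in> {1..n}" for i
    proof -
      have "F i = f ` flag \<sigma> (size_upto i)"
        using image_flag[OF \<sigma>(1) \<tau>(1)] \<tau>(2)[of i] i unfolding f_def by simp
      then show ?thesis using \<sigma>(2)[OF i] rk_relabel[OF inj] by simp
    qed
    have sym: "sym_indicator (matroid_polytope ?N) = sym_indicator (matroid_polytope N)"
      by (rule sym_indicator_relabel[OF bij])
    have "flag_sum weight ?N = flag_sum weight N"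
      using matroid_relabel[OF inj NM(1)] ground NM sym by (intro flag_sum_eq_if_sym_indicator_eq)
    then show ?thesis
      using flag_sum_weight_le_if_tight[OF mem spread tightF] sym by metis
  qed
  then show "flag_sum weight N \<le> flag_sum weight M"
    and "flag_sum weight N = flag_sum weight M \<Longrightarrow>
      sym_indicator (matroid_polytope N) = sym_indicator (matroid_polytope M)"
    by auto
qed

text \<open>The coordinate vector of \<open>M\<close> is a unit vector. The functional \<open>\<Phi>\<close> takes the value \<open>flag_sum weight L\<close> on
every coordinate vector of \<open>L\<close>, so it is maximal only at coordinate vectors of matroids with the
symmetrized indicator function of \<open>M\<close>; by linear independence there is only one such vector.\<close>

lemma extremal_M:
  fixes N :: "'k::finite \<Rightarrow> 'e set_system"
  assumes N: "enumerates_nested (rank_upto n) N"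
  shows "extremal N M"
proof -
  obtain i0 where "matroid_iso M (N i0)"
    using N M_in_matroids_of_rank nested_M unfolding enumerates_nested_def by blast
  then obtain f where f: "bij_betw f (ground M) (ground (N i0))"
    and iff: "\<And>X. X \<subseteq> ground M \<Longrightarrow> X \<in> indep M \<longleftrightarrow> f ` X \<in> indep (N i0)"
    unfolding matroid_iso_def by blast
  have gN: "ground (N i0) = UNIV" using N by (auto simp: enumerates_nested_def matroids_of_rank_def)
  have bij: "bij f" using f ground_M gN by simp
  have "N i0 = relabel f M"
  proof (rule set_system.expand, intro conjI)
    show "ground (N i0) = ground (relabel f M)"
      using bij by (simp add: gN relabel_def ground_M bij_is_surj)
    show "indep (N i0) = indep (relabel f M)"
    proof (intro set_eqI iffI)
      fix Y assume Y: "Y \<in> indep (N i0)"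
      have "Y = f ` (inv f ` Y)" using bij by (simp add: image_f_inv_f bij_is_surj)
      then show "Y \<in> indep (relabel f M)"
        using Y iff[of "inv f ` Y"] ground_M by (auto simp: relabel_def)
    qed (use iff ground_M in \<open>auto simp: relabel_def\<close>)
  qed
  then have sym0: "sym_indicator (matroid_polytope (N i0)) = sym_indicator (matroid_polytope M)"
    using sym_indicator_relabel[OF bij] by simp
  define v :: "real ^ 'k" where "v = axis i0 1"
  have v_nth: "v $ i = (if i = i0 then 1 else 0)" for i by (auto simp: v_def axis_def)
  have v: "is_coord_vec N M v"
    unfolding is_coord_vec_def by (auto simp: v_nth sym0 if_distrib[of "\<lambda>c. c * _"] cong: if_cong)
  define \<Phi> :: "real ^ 'k \<Rightarrow> real"
    where "\<Phi> w = (\<Sum>i\<in>UNIV. w $ i * flag_sum weight (N i))" for w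
  have \<Phi>: "\<Phi> w = flag_sum weight L" if "L \<in> matroids_of_rank (rank_upto n)" "is_coord_vec N L w" for L w
    using flag_sum_eq_of_coord_vec[OF N, of L w weight] that
    by (simp add: \<Phi>_def matroids_of_rank_def)
  have "v extreme_point_of (convex hull {w. \<exists>L\<in>matroids_of_rank (rank_upto n). is_coord_vec N L w})"
  proof (rule extreme_point_of_convex_hull_if_unique_max)
    show "linear \<Phi>"
      unfolding \<Phi>_def
      by (rule linearI) (simp_all add: algebra_simps sum.distrib sum_distrib_left)
    show "v \<in> {w. \<exists>L\<in>matroids_of_rank (rank_upto n). is_coord_vec N L w}"
      using v M_in_matroids_of_rank by blast
    fix w assume "w \<in> {w. \<exists>L\<in>matroids_of_rank (rank_upto n). is_coord_vec N L w}" and wv: "w \<noteq> v"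
    then obtain L where L: "L \<in> matroids_of_rank (rank_upto n)" "is_coord_vec N L w" by blast
    have "sym_indicator (matroid_polytope L) \<noteq> sym_indicator (matroid_polytope M)"
    proof
      assume sym: "sym_indicator (matroid_polytope L) = sym_indicator (matroid_polytope M)"
      have "w $ i - v $ i = 0" for i
      proof (rule nested_sym_indicators_independent[OF N])
        show "(\<Sum>i\<in>UNIV. (w $ i - v $ i) * sym_indicator (matroid_polytope (N i)) x) = 0" for x
          using L(2) v sym by (simp add: is_coord_vec_def left_diff_distrib sum_subtractf)
      qed
      then show False using wv by (simp add: vec_eq_iff)
    qed
    then show "\<Phi> w < \<Phi> v"
      using flag_sum_weight_le[OF L(1)] \<Phi>[OF L] \<Phi>[OF M_in_matroids_of_rank v] by force
  qed
  then show ?thesis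
    using v unfolding extremal_def Omega_def rk_M_UNIV by blast
qed

end

theorem corollary4p9:
  fixes n :: nat and a b :: "nat \<Rightarrow> nat"
    and S :: "nat \<Rightarrow> 'e::finite set"
    and N :: "'k::finite \<Rightarrow> 'e set_system"
    and M :: "'e set_system"
  assumes "n \<ge> 1"
    and "\<forall>i\<in>{1..n}. 0 < a i \<and> 0 < b i"
    and "\<forall>i\<in>{1..n}. card (S i) = a i + b i"
    and "disjoint_family_on S {1..n}"
    and "(\<Union>i\<in>{1..n}. S i) = UNIV"
    and "M = free_products (map (\<lambda>i. uniform_matroid (a i) (S i)) [1..<Suc n])"
    and "enumerates_nested (rk M UNIV) N"
    and "(\<forall>i\<in>{1..n-1}. a i < a (i+1)) \<or>
         (\<forall>i\<in>{1..n-1}. b (i+1) < b i) \<or>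
         (n \<ge> 3 \<and> (\<exists>k\<in>{1..n-2}. (\<forall>i\<in>{1..k}. a i < a (i+1)) \<and>
            (\<forall>i\<in>{1..n-1} - {1..k}. b (i+1) < b i)))"
  shows "extremal N M"
proof -
  obtain k where k: "k < n" "\<forall>i\<in>{1..k}. a i < a (i + 1)" "\<forall>i\<in>{k+1..n-1}. b (i + 1) < b i"
  proof -
    from assms(8) consider "\<forall>i\<in>{1..n-1}. a i < a (i+1)" | "\<forall>i\<in>{1..n-1}. b (i+1) < b i"
      | k where "n \<ge> 3" "k \<in> {1..n-2}" "\<forall>i\<in>{1..k}. a i < a (i+1)"
        "\<forall>i\<in>{1..n-1} - {1..k}. b (i+1) < b i"
      by blast
    then show thesis
    proof cases
      case 1
      then show ?thesis using assms(1) by (intro that[of "n - 1"]) auto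
    next
      case 2
      then show ?thesis using assms(1) by (intro that[of 0]) auto
    next
      case 3
      then show ?thesis by (intro that[of k]) auto
    qed
  qed
  interpret pivoted_blocks n k a b S
    using assms(2-5) k by unfold_locales auto
  have "M = pivoted_blocks.M n a S"
    unfolding assms(6) M_def F_def rank_upto_def assms(5)[symmetric]
    using assms(1,3,4) by (intro free_products_uniform_eq_capped) auto
  then show ?thesis
    using assms(7) extremal_M rk_M_UNIV by simp
qed

end
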